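(* Let $n\ge1$ be an integer and let $0=\nu_1\le\nu_2\le\cdots\le\nu_n$ be fixed integers. Then for $\xi,\eta$ in a compact subset of $\mathbb{C}$, $$\mathbb{K}_n(\xi,\eta)=\lim_{N\to+\infty}K_{n,N}\Big(\frac{\xi}{N^{n/2}},\frac{\eta}{N^{n/2}}\Big)=\frac{\sqrt{\omega_n(\xi)\,\omega_n(\eta)}}{\pi\prod_{i=1}^n\Gamma(1+\nu_i)}\;{}_0F_{n-1}\big(-;\,1+\nu_2,\ldots,1+\nu_n;\,\xi\,\overline{\eta}\big),$$ where $\mathbb{K}_n$ denotes this limit and $$\omega_n(\xi)=|\xi|^{2\nu_n}\,G_{0,n}^{n,0}\left(\begin{matrix}-\\ -\nu_n,\ \nu_2-\nu_n,\ldots,\nu_{n-1}-\nu_n,\ 0\end{matrix}\;\Big|\;|\xi|^2\right).$$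
   Context: For integers $n,N\ge1$ and $0=\nu_1\le\cdots\le\nu_n$, the weight $\omega_{n,N}$ is $$\omega_{n,N}(z)=\int_{\mathbb{C}^n}\prod_{j=1}^n\frac{|x_j|^{2\nu_j}}{(1+|x_j|^2)^{\nu_j+N+1}}\;\delta\Big(z-\prod_{j=1}^n x_j\Big)\,d^2x_1\cdots d^2x_n ,$$ where $d^2x$ is Lebesgue measure on $\mathbb{C}$ and $\delta$ is the Dirac delta on $\mathbb{C}$ (for $n=1$, $\omega_{1,N}(z)=(1+|z|^2)^{-N-1}$). The kernel of orthonormal polynomials with respect to this weight is $$K_{n,N}(z,w)=\frac1{\pi^n}\sqrt{\omega_{n,N}(z)\,\omega_{n,N}(w)}\;\sum_{k=0}^{N-1}\frac1{\Gamma(N-k)^n}\prod_{i=1}^n\frac{\Gamma(\nu_i+N+1)}{\Gamma(\nu_i+k+1)}\,(z\overline{w})^k .$$ $G_{0,n}^{n,0}$ is the Meijer G-function, given by the Mellin-Barnes integral $$G_{0,n}^{n,0}\left(\begin{matrix}-\\ b_1,\ldots,b_n\end{matrix}\Big|\,x\right)=\frac1{2\pi i}\int_{c-i\infty}^{c+i\infty}\prod_{j=1}^n\Gamma(b_j+s)\;x^{-s}\,ds,\qquad c>-\min_j b_j ,$$ and the lower parameters in the claim are $b_j=\nu_j-\nu_n$, $j=1,\dots,n$ (the single parameter $0$ if $n=1$). Finally, ${}_0F_{n-1}(-;b_1,\ldots,b_{n-1};x)=\sum_{k\ge0}\frac{1}{(b_1)_k\cdots(b_{n-1})_k}\frac{x^k}{k!}$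 with $(b)_k=b(b+1)\cdots(b+k-1)$.
   Formalization: The limit is of N^{-n}K_{n,N}(ξ/N^{n/2},η/N^{n/2}); without N^{-n} it diverges (n=1, ξ=η=0 gives N/π). If n≥2 and ν_2=0 the compact set must not contain 0, where the weights are infinite; otherwise ω_n(0) means the limit of ω_n(ξ) as ξ→0. *)

theory Defs
  imports "HOL-Analysis.Analysis"
begin

definition factor_weight :: "nat \<Rightarrow> nat \<Rightarrow> complex \<Rightarrow> real" where
  "factor_weight m N x = norm x ^ (2 * m) / (1 + (norm x)\<^sup>2) ^ (m + N + 1)"

(* The delta function is integrated out in the first variable: for fixed x_2, ..., x_n with
   p = x_2 * ... * x_n nonzero, the substitution u = x_1 * p (real Jacobian |p|^2) gives
     integral f(x_1) delta(z - x_1 * p) d^2x_1 = f(z / p) / |p|^2.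
   For n = 1 the product measure is the unit mass at the empty family.  The first variable is
   the one with nu_1 = 0, so that the formula also gives the correct value at z = 0 whenever
   the weight is finite there, i.e. when n = 1 or nu_2 > 0.  When n >= 2 and nu_2 = 0 the
   integral diverges at z = 0 (logarithmic singularity) and the Bochner integral is then 0 by
   convention. *)
definition product_weight :: "(nat \<Rightarrow> nat) \<Rightarrow> nat \<Rightarrow> nat \<Rightarrow> complex \<Rightarrow> real" where
  "product_weight \<nu> n N z =
     (LINT x | PiM {2..n} (\<lambda>_. lborel).
        factor_weight (\<nu> 1) N (z / (\<Prod>j=2..n. x j)) *
        (\<Prod>j=2..n. factor_weight (\<nu> j) N (x j)) / (norm (\<Prod>j=2..n. x j))\<^sup>2)"

lemma product_weight_one:
  assumes "\<nu> 1 = 0"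
  shows "product_weight \<nu> 1 N z = 1 / (1 + (norm z)\<^sup>2) ^ (N + 1)"
  using assms by (simp add: product_weight_def factor_weight_def PiM_empty
      lebesgue_integral_count_space_finite)

(* The kernel acts with respect to d^2z.  In the coordinate xi = N^(n/2) * z one has
   d^2z = N^(-n) d^2xi, so the kernel with respect to d^2xi is
     N^(-n) * K (xi / N^(n/2)) (eta / N^(n/2)). *)
definition product_kernel :: "(nat \<Rightarrow> nat) \<Rightarrow> nat \<Rightarrow> nat \<Rightarrow> complex \<Rightarrow> complex \<Rightarrow> complex" where
  "product_kernel \<nu> n N z w =
     of_real (1 / pi ^ n * sqrt (product_weight \<nu> n N z * product_weight \<nu> n N w)) *
     (\<Sum>k<N. of_real (1 / Gamma (real N - real k) ^ n *
                      (\<Prod>i=1..n. Gamma (real (\<nu> i) + real N + 1) / Gamma (real (\<nu> i) + real k + 1))) *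
             (z * cnj w) ^ k)"

(* The Meijer function G^{n,0}_{0,n} with lower parameters b j (j in the finite index set J,
   n = card J) at a real x > 0.  The contour integral runs along the vertical line
   s = c + i t, ds = i dt; its value does not depend on the choice of c > - Min (b ` J). *)
definition meijer_G :: "real \<Rightarrow> 'i set \<Rightarrow> ('i \<Rightarrow> real) \<Rightarrow> real \<Rightarrow> complex" where
  "meijer_G c J b x =
     1 / (2 * of_real pi * \<i>) *
     (LINT t | lborel.
        (\<Prod>j\<in>J. Gamma (of_real (b j) + Complex c t)) * of_real x powr (- Complex c t) * \<i>)"

(* At 0, where the Mellin-Barnes integral is not defined, the weight is given its continuous
   extension; it exists exactly when n = 1 or nu_2 > 0. *)
definition limit_weight :: "real \<Rightarrow> (nat \<Rightarrow> nat) \<Rightarrow> nat \<Rightarrow> complex \<Rightarrow> complex" where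
  "limit_weight c \<nu> n \<xi> =
     (let w = (\<lambda>z. of_real (norm z ^ (2 * \<nu> n)) *
                   meijer_G c {1..n} (\<lambda>j. real (\<nu> j) - real (\<nu> n)) ((norm z)\<^sup>2))
      in if \<xi> = 0 then Lim (at 0) w else w \<xi>)"

(* The hypergeometric function with no upper parameters and the lower parameters b j, j in J. *)
definition hypergeom_0F :: "'i set \<Rightarrow> ('i \<Rightarrow> complex) \<Rightarrow> complex \<Rightarrow> complex" where
  "hypergeom_0F J b x = (\<Sum>k. 1 / (\<Prod>j\<in>J. pochhammer (b j) k) * (x ^ k / fact k))"

end

theory Submission
  imports Defs "HOL-Probability.Characteristic_Functions" "HOL-Probability.Sinc_Integral"
begin

text \<open>
  After rescaling every variable by \<open>sqrt N\<close>, and up to the factor \<open>1 / (\<Prod>j. N ^ \<nu> j)\<close>, the weight at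
  the rescaled point is an integral with factors \<open>u ^ \<nu> j / (1 + u / N) ^ (\<nu> j + N + 1)\<close>, where
  \<open>u = |x j|\<^sup>2\<close>, and these converge to \<open>u ^ \<nu> j * exp (- u)\<close>.
  The powers of \<open>N\<close> are absorbed by the Gamma quotients in the kernel, which then tend to 1.
  Dominated convergence (for the weight) and Tannery's theorem (for the sum) are applied with
  \<open>N\<close> and the point moving simultaneously: such continuous convergence is uniform on compact sets and
  makes the limit continuous, which also gives its value at 0. The limit weight is identified with
  the Meijer function by inserting the Cahen-Mellin integral for \<open>exp (- u)\<close> in the first factor and
  exchanging the integrals; absolute convergence on the vertical line comes from
  \<open>\<Gamma>(s) = \<Gamma>(s + 2) / (s (s + 1))\<close>, and the Cahen-Mellin integral itself is Fourier inversion
  for \<open>exp (a u - exp u)\<close>.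
\<close>

subsection \<open>Fourier inversion and the Cahen-Mellin integral\<close>

text \<open>The obstacle is the factor \<open>1 / |x j|^2\<close> that the delta function leaves in
  each variable with \<open>j >= 2\<close>. When \<open>\<nu> j = 0\<close> it is not integrable at
  the origin of the plane, and only the decay of the first factor, whose argument is
  \<open>|z|^2\<close> divided by the product of the \<open>|x j|^2\<close>, can compensate; this
  requires \<open>z\<close> to stay away from 0. Hence the alternative between positive
  \<open>\<nu> j\<close> and nonzero points. At infinity the majorant comes from bounding
  \<open>(1 + u / N) ^ N\<close> below by a fixed power \<open>K\<close>, valid for all
  \<open>N >= K\<close>. Since integrands see only squared moduli, each complex variable becomes a
  half-line integral with weight \<open>pi\<close>; these \<open>n - 1\<close> factors leave a
  single \<open>pi\<close> from the \<open>pi ^ n\<close> of the kernel.\<close>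

lemma (in pair_sigma_finite) integrable_mult_bounded:
  fixes f g :: "_ \<Rightarrow> complex"
  assumes f: "integrable M1 f" and g: "integrable M2 g"
    and \<phi>[measurable]: "\<phi> \<in> borel_measurable (M1 \<Otimes>\<^sub>M M2)" and bd: "\<And>p. norm (\<phi> p) \<le> 1"
  shows "integrable (M1 \<Otimes>\<^sub>M M2) (\<lambda>(x, y). f x * g y * \<phi> (x, y))"
proof -
  have [measurable]: "f \<in> borel_measurable M1" "g \<in> borel_measurable M2"
    using f g by auto
  \<comment> \<open>The coupling of the two variables sits entirely in \<open>\<phi>\<close>, later
    an oscillating phase, so a product of two integrable functions serves as majorant.\<close>
  have "integrable (M1 \<Otimes>\<^sub>M M2) (\<lambda>(x, y). f x * g y)"
  proof (rule Fubini_integrable)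
    show "integrable M1 (\<lambda>x. \<integral>y. norm ((\<lambda>(x, y). f x * g y) (x, y)) \<partial>M2)"
      using f by (simp add: norm_mult)
    show "AE x in M1. integrable M2 (\<lambda>y. (\<lambda>(x, y). f x * g y) (x, y))"
      using g by simp
  qed measurable
  then show ?thesis
  proof (rule Bochner_Integration.integrable_bound)
    show "AE x in M1 \<Otimes>\<^sub>M M2. norm (case x of (x, y) \<Rightarrow> f x * g y * \<phi> (x, y))
        \<le> norm (case x of (x, y) \<Rightarrow> f x * g y)"
      using bd by (intro AE_I2) (auto simp: norm_mult intro!: mult_left_le)
  qed measurable
qed

text \<open>The substitution \<open>x = \<sigma> * t\<close> carries the characteristic function of
  the standard normal law, taken at \<open>a / \<sigma>\<close>, into the transform of an
  unnormalised Gaussian.\<close>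

lemma gaussian_fourier:
  fixes a \<sigma> :: real
  assumes "\<sigma> > 0"
  shows "(LINT t|lborel. iexp (t * a) * of_real (exp (- (\<sigma> * t)\<^sup>2 / 2))) =
    of_real (sqrt (2 * pi) / \<sigma> * exp (- (a / \<sigma>)\<^sup>2 / 2))"
proof -
  have "of_real (exp (- ((a / \<sigma>)\<^sup>2) / 2)) = char std_normal_distribution (a / \<sigma>)"
    by (simp add: char_std_normal_distribution)
  also have "\<dots> = (LINT x|lborel. std_normal_density x *\<^sub>R iexp (a / \<sigma> * x))"
    unfolding char_def by (subst integral_density) auto
  also have "\<dots> = \<bar>\<sigma>\<bar> *\<^sub>R (LINT t|lborel. std_normal_density (0 + \<sigma> * t) *\<^sub>R iexp (a / \<sigma> * (0 + \<sigma> * t)))"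
    using assms by (intro lborel_integral_real_affine) auto
  also have "\<dots> = \<bar>\<sigma>\<bar> *\<^sub>R (LINT t|lborel. of_real (1 / sqrt (2 * pi)) *
      (iexp (t * a) * of_real (exp (- (\<sigma> * t)\<^sup>2 / 2))))"
    using assms by (simp add: normal_density_def scaleR_conv_of_real mult_ac)
  also have "\<dots> = of_real (\<sigma> / sqrt (2 * pi)) *
      (LINT t|lborel. iexp (t * a) * of_real (exp (- (\<sigma> * t)\<^sup>2 / 2)))"
    using assms by (subst integral_mult_right_zero) (simp add: scaleR_conv_of_real)
  finally show ?thesis using assms
    by (simp add: field_simps)
qed

text \<open>Gaussian summation: damping the transform permits the exchange of integrals, after which
  the left side is an average of \<open>h\<close> over a Gaussian of width \<open>\<sigma> k\<close>
  around \<open>y\<close>. Both sides pass to the limit by domination, one through integrability of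
  the transform, the other through the bound \<open>B\<close>.\<close>

lemma fourier_inversion:
  fixes h :: "real \<Rightarrow> complex"
  assumes h: "integrable lborel h" and bd: "\<And>u. norm (h u) \<le> B" and cont: "isCont h y"
    and H: "integrable lborel (\<lambda>t. LINT u|lborel. h u * iexp (t * u))"
  shows "(LINT t|lborel. (LINT u|lborel. h u * iexp (t * u)) * iexp (- (t * y))) = 2 * pi * h y"
proof -
  have [measurable]: "h \<in> borel_measurable borel"
    using h by auto
  define H' where "H' = (\<lambda>t. LINT u|lborel. h u * iexp (t * u))"
  have [measurable]: "H' \<in> borel_measurable borel" and H': "integrable lborel H'"
    using H by (auto simp: H'_def)
  define \<sigma> where "\<sigma> k = 1 / real (Suc k)" for k
  have \<sigma>: "\<sigma> k > 0" for k by (simp add: \<sigma>_def)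
  have \<sigma>0: "\<sigma> \<longlonglongrightarrow> 0"
    unfolding \<sigma>_def by (rule LIMSEQ_Suc[OF lim_1_over_n])
  define g where "g s t = complex_of_real (exp (- (s * t)\<^sup>2 / 2))" for s t :: real
  have [measurable]: "g s \<in> borel_measurable borel" for s
    unfolding g_def by measurable
  have g1: "integrable lborel (g 1)"
  proof -
    have "integrable lborel (\<lambda>t. complex_of_real (sqrt (2 * pi) * std_normal_density t))"
      by (intro integrable_of_real integrable_mult_right) auto
    then show ?thesis by (simp add: g_def[abs_def] normal_density_def)
  qed
  have g: "integrable lborel (g (\<sigma> k))" for k
    using lborel_integrable_real_affine[OF g1, of "\<sigma> k" 0] \<sigma>[of k] by (simp add: g_def[abs_def])
  have A: "(\<lambda>k. LINT t|lborel. H' t * iexp (- (t * y)) * g (\<sigma> k) t)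
      \<longlonglongrightarrow> (LINT t|lborel. H' t * iexp (- (t * y)))"
  proof (rule integral_dominated_convergence[where w = "\<lambda>t. norm (H' t)"])
    show "AE t in lborel. (\<lambda>k. H' t * iexp (- (t * y)) * g (\<sigma> k) t) \<longlonglongrightarrow> H' t * iexp (- (t * y))"
    proof (rule AE_I2)
      fix t
      have "(\<lambda>k. H' t * iexp (- (t * y)) * g (\<sigma> k) t) \<longlonglongrightarrow> H' t * iexp (- (t * y)) * g 0 t"
        unfolding g_def by (intro tendsto_intros \<sigma>0) auto
      then show "(\<lambda>k. H' t * iexp (- (t * y)) * g (\<sigma> k) t) \<longlonglongrightarrow> H' t * iexp (- (t * y))"
        by (simp add: g_def)
    qed
    show "AE t in lborel. norm (H' t * iexp (- (t * y)) * g (\<sigma> k) t) \<le> norm (H' t)" for k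
      by (intro AE_I2) (auto simp: norm_mult g_def mult_left_le)
  qed (use H' in auto)
  have B: "(LINT t|lborel. H' t * iexp (- (t * y)) * g (\<sigma> k) t) =
      (LINT v|lborel. h (y + \<sigma> k * v) * (of_real (sqrt (2 * pi)) * g 1 v))" for k
  proof -
    have "(LINT t|lborel. H' t * iexp (- (t * y)) * g (\<sigma> k) t) =
        (LINT t|lborel. LINT u|lborel. h u * g (\<sigma> k) t * iexp (t * (u - y)))"
    proof (rule Bochner_Integration.integral_cong[OF refl])
      fix t
      have "H' t * iexp (- (t * y)) * g (\<sigma> k) t =
          (LINT u|lborel. h u * iexp (t * u)) * (iexp (- (t * y)) * g (\<sigma> k) t)"
        by (simp add: H'_def mult.assoc)
      also have "\<dots> = (LINT u|lborel. h u * iexp (t * u) * (iexp (- (t * y)) * g (\<sigma> k) t))"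
        by (rule integral_mult_left_zero[symmetric])
      also have "\<dots> = (LINT u|lborel. h u * g (\<sigma> k) t * iexp (t * (u - y)))"
        by (intro Bochner_Integration.integral_cong refl) (simp add: algebra_simps exp_diff exp_minus field_simps)
      finally show "H' t * iexp (- (t * y)) * g (\<sigma> k) t =
          (LINT u|lborel. h u * g (\<sigma> k) t * iexp (t * (u - y)))" .
    qed
    also have "\<dots> = (LINT u|lborel. LINT t|lborel. h u * g (\<sigma> k) t * iexp (t * (u - y)))"
      using lborel_pair.integrable_mult_bounded[OF h g, of "\<lambda>(u, t). iexp (t * (u - y))" k]
      by (intro lborel_pair.Fubini_integral) (simp add: split_beta')
    also have "\<dots> = (LINT u|lborel. h u * of_real (sqrt (2 * pi) / \<sigma> k * exp (- ((u - y) / \<sigma> k)\<^sup>2 / 2)))"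
      by (subst gaussian_fourier[OF \<sigma>, symmetric])
         (simp add: g_def mult_ac flip: integral_mult_right_zero)
    \<comment> \<open>Substituting \<open>u = y + \<sigma> k * v\<close> moves the shrinking width
      into the argument of \<open>h\<close>, where continuity at \<open>y\<close> can act.\<close>
    also have "\<dots> = \<bar>\<sigma> k\<bar> *\<^sub>R (LINT v|lborel. h (y + \<sigma> k * v) *
        of_real (sqrt (2 * pi) / \<sigma> k * exp (- ((y + \<sigma> k * v - y) / \<sigma> k)\<^sup>2 / 2)))"
      using \<sigma>[of k] by (intro lborel_integral_real_affine) auto
    also have "\<dots> = (LINT v|lborel. h (y + \<sigma> k * v) * (of_real (sqrt (2 * pi)) * g 1 v))"
      using \<sigma>[of k] by (subst integral_scaleR_right[symmetric])
        (auto intro!: Bochner_Integration.integral_cong simp: g_def scaleR_conv_of_real)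
    finally show ?thesis .
  qed
  have C: "(\<lambda>k. LINT v|lborel. h (y + \<sigma> k * v) * (of_real (sqrt (2 * pi)) * g 1 v))
      \<longlonglongrightarrow> (LINT v|lborel. h y * (of_real (sqrt (2 * pi)) * g 1 v))"
  proof (rule integral_dominated_convergence[where w = "\<lambda>v. B * (sqrt (2 * pi) * norm (g 1 v))"])
    show "AE v in lborel. (\<lambda>k. h (y + \<sigma> k * v) * (of_real (sqrt (2 * pi)) * g 1 v))
        \<longlonglongrightarrow> h y * (of_real (sqrt (2 * pi)) * g 1 v)"
    proof (intro AE_I2 tendsto_intros isCont_tendsto_compose[OF cont])
      fix v show "(\<lambda>k. y + \<sigma> k * v) \<longlonglongrightarrow> y"
        using tendsto_add[OF tendsto_const tendsto_mult[OF \<sigma>0 tendsto_const], of y v] by simp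
    qed
    show "AE v in lborel. norm (h (y + \<sigma> k * v) * (of_real (sqrt (2 * pi)) * g 1 v))
        \<le> B * (sqrt (2 * pi) * norm (g 1 v))" for k
      by (intro AE_I2) (auto simp: norm_mult intro!: mult_right_mono bd)
  qed (use g1 in auto)
  \<comment> \<open>One \<open>sqrt (2 * pi)\<close> came from the transform of the damping factor;
    this total mass is the second, and together they give \<open>2 * pi\<close>.\<close>
  have D: "(LINT v|lborel. g 1 v) = of_real (sqrt (2 * pi))"
    using gaussian_fourier[of 1 0] by (simp add: g_def)
  have "(LINT t|lborel. H' t * iexp (- (t * y))) = (LINT v|lborel. h y * (of_real (sqrt (2 * pi)) * g 1 v))"
    using LIMSEQ_unique[OF A] C B by simp
  also have "\<dots> = 2 * pi * h y"
    by (simp add: D flip: of_real_mult)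
  finally show ?thesis by (simp add: H'_def)
qed

section \<open>Changes of variables: logarithm and squared modulus\<close>

text \<open>\<open>dr / r\<close> gives the interval from \<open>exp l\<close> to
  \<open>exp u\<close> the mass \<open>u - l\<close>. As an identity of measures, this makes the
  substitution \<open>r = exp u\<close> available for complex Bochner integrals.\<close>

lemma lborel_eq_distr_ln:
  "(lborel :: real measure) =
    distr (density lborel (\<lambda>r. ennreal (indicator {0<..} r / r))) borel ln"
proof (rule lborel_eqI)
  fix l u :: real
  assume "\<And>b. b \<in> Basis \<Longrightarrow> l \<bullet> b \<le> u \<bullet> b"
  then have lu: "l \<le> u" by simp
  have eq: "ennreal (indicator {0<..} r / r) * indicator (ln -` box l u) r =
      ennreal (1 / r) * indicator {exp l<..<exp u} r" for r :: real
  proof (cases "r > 0")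
    case True
    then obtain v where "r = exp v" by (metis exp_ln)
    then show ?thesis by (auto simp: indicator_def)
  qed (auto simp: indicator_def dest: less_trans[OF exp_gt_zero])
  have "emeasure (distr (density lborel (\<lambda>r. ennreal (indicator {0<..} r / r))) borel ln) (box l u) =
      (\<integral>\<^sup>+ r. ennreal (1 / r) * indicator {exp l<..<exp u} r \<partial>lborel)"
    using measurable_sets_borel[of ln borel "box l u"]
    by (subst emeasure_distr) (auto simp: emeasure_density eq simp del: box_real)
  also have "\<dots> = (\<integral>\<^sup>+ r. ennreal (1 / r) * indicator {exp l..exp u} r \<partial>lborel)"
  proof (rule nn_integral_cong_AE)
    show "AE r in lborel. ennreal (1 / r) * indicator {exp l<..<exp u} r =
        ennreal (1 / r) * indicator {exp l..exp u} r"
      using AE_lborel_singleton[of "exp l"] AE_lborel_singleton[of "exp u"]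
      by eventually_elim (auto simp: indicator_def)
  qed
  also have "\<dots> = ln (exp u) - ln (exp l)"
    using lu by (intro nn_integral_FTC_Icc)
      (auto intro!: derivative_eq_intros simp: divide_inverse dest: less_le_trans[OF exp_gt_zero])
  finally show "emeasure (distr (density lborel (\<lambda>r. ennreal (indicator {0<..} r / r))) borel ln) (box l u) =
      (\<Prod>b\<in>Basis. (u - l) \<bullet> b)"
    by simp
qed simp

text \<open>The disc of radius \<open>sqrt a\<close> has area \<open>pi * a\<close>, and half-lines
  form an intersection-stable generator. This is polar coordinates with the angle already integrated
  out.\<close>

lemma distr_lborel_cmod_squared:
  "distr lborel borel (\<lambda>z::complex. (norm z)\<^sup>2) = density lborel (\<lambda>r. ennreal (pi * indicator {0<..} r))"
proof (rule measure_eqI_generator_eq[where E = "range atMost" and A = "\<lambda>i::nat. {..real i}" and \<Omega> = UNIV])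
  have eq: "emeasure (distr lborel borel (\<lambda>z::complex. (norm z)\<^sup>2)) {..a} = ennreal (pi * max 0 a)"
    "emeasure (density lborel (\<lambda>r. ennreal (pi * indicator {0<..} r))) {..a} = ennreal (pi * max 0 a)" for a
  proof -
    have "(\<lambda>z::complex. (norm z)\<^sup>2) -` {..a} = (if a < 0 then {} else cball 0 (sqrt a))"
      by (auto simp: real_le_rsqrt dest: order_trans[OF zero_le_power2] real_sqrt_le_mono)
        (metis abs_of_nonneg norm_ge_zero real_sqrt_abs real_sqrt_le_iff real_le_lsqrt real_sqrt_pow2 not_less power_mono)+
    then show "emeasure (distr lborel borel (\<lambda>z::complex. (norm z)\<^sup>2)) {..a} = ennreal (pi * max 0 a)"
      by (subst emeasure_distr) (auto simp: emeasure_cball unit_ball_vol_2)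
    have "emeasure (density lborel (\<lambda>r. ennreal (pi * indicator {0<..} r))) {..a} =
       (\<integral>\<^sup>+ r. ennreal pi * indicator {0<..a} r \<partial>lborel)"
      by (subst emeasure_density) (auto intro!: nn_integral_cong simp: indicator_def)
    also have "\<dots> = ennreal pi * emeasure lborel {0<..a}"
      by (rule nn_integral_cmult_indicator) auto
    also have "\<dots> = ennreal (pi * max 0 a)"
      by (cases "a \<ge> 0") (auto simp: ennreal_mult)
    finally show "emeasure (density lborel (\<lambda>r. ennreal (pi * indicator {0<..} r))) {..a} = ennreal (pi * max 0 a)" .
  qed
  show "emeasure (distr lborel borel (\<lambda>z::complex. (norm z)\<^sup>2)) X =
      emeasure (density lborel (\<lambda>r. ennreal (pi * indicator {0<..} r))) X" if "X \<in> range atMost" for X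
    using that eq by auto
  show "emeasure (distr lborel borel (\<lambda>z::complex. (norm z)\<^sup>2)) {..real i} \<noteq> \<infinity>" for i
    by (simp add: eq)
  show "(\<Union>i. {..real i}) = UNIV"
    using real_arch_simple by auto
qed (auto simp: Int_stable_def borel_eq_atMost)

lemma has_bochner_integral_cmod_squared:
  fixes f :: "real \<Rightarrow> 'a::{banach, second_countable_topology}"
  assumes "f \<in> borel_measurable borel"
    and "has_bochner_integral lborel (\<lambda>r. indicator {0<..} r *\<^sub>R f r) I"
  shows "has_bochner_integral lborel (\<lambda>z::complex. f ((norm z)\<^sup>2)) (pi *\<^sub>R I)"
proof -
  have "has_bochner_integral (density lborel (\<lambda>r. ennreal (pi * indicator {0<..} r))) f (pi *\<^sub>R I)"
    using assms(1) has_bochner_integral_scaleR_right[OF assms(2), of pi]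
    by (intro has_bochner_integral_density) auto
  then have "has_bochner_integral (distr lborel borel (\<lambda>z::complex. (norm z)\<^sup>2)) f (pi *\<^sub>R I)"
    by (simp add: distr_lborel_cmod_squared)
  then show ?thesis
    using assms(1) by (simp add: has_bochner_integral_iff integrable_distr_eq integral_distr)
qed

section \<open>Integral representations of Gamma and its decay on vertical lines\<close>

lemma has_bochner_integral_Gamma:
  assumes "Re z > 0"
  shows "has_bochner_integral lborel
    (\<lambda>r. indicator {0<..} r *\<^sub>R (exp ((z - 1) * of_real (ln r)) * exp (- of_real r))) (Gamma z)"
proof -
  let ?f = "\<lambda>r. indicator {0<..} r *\<^sub>R (exp ((z - 1) * of_real (ln r)) * exp (- of_real r))"
  have eq: "indicator {0<..} r *\<^sub>R (of_real r powr (z - 1) / of_real (exp r)) = ?f r" for r :: real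
    by (auto simp: indicator_def powr_def Ln_of_real exp_minus field_simps exp_of_real)
  have "set_integrable lebesgue {0<..} (\<lambda>t. complex_of_real t powr (z - 1) / of_real (exp t))"
    using absolutely_integrable_Gamma_integral'[OF assms] .
  moreover have "(LINT t:{0<..}|lebesgue. complex_of_real t powr (z - 1) / of_real (exp t)) = Gamma z"
    using set_lebesgue_integral_eq_integral(2)[OF absolutely_integrable_Gamma_integral'[OF assms]]
      Gamma_integral_complex'[OF assms] by (simp add: integral_unique)
  ultimately have "has_bochner_integral lebesgue ?f (Gamma z)"
    unfolding set_integrable_def set_lebesgue_integral_def eq by (simp add: has_bochner_integral_iff)
  \<comment> \<open>Euler's integral is taken over the completed measure; Borel measurability of the
    integrand lets it descend to \<open>lborel\<close>.\<close>
  moreover have "?f \<in> borel_measurable lborel"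
    by measurable
  ultimately show ?thesis
    by (simp add: has_bochner_integral_iff integrable_completion integral_completion)
qed

text \<open>With \<open>r = exp u\<close> Euler's integral becomes a two-sided Laplace transform; on
  the line \<open>z = a + i t\<close> it is the Fourier transform of
  \<open>exp (a * u - exp u)\<close>.\<close>

lemma has_bochner_integral_Gamma_exp:
  assumes "Re z > 0"
  shows "has_bochner_integral lborel (\<lambda>u. exp (z * of_real u - of_real (exp u))) (Gamma z)"
proof -
  let ?f = "\<lambda>u. exp (z * of_real u - of_real (exp u))"
  have [measurable]: "?f \<in> borel_measurable borel"
    by measurable
  have eq: "(indicator {0<..} r / r) *\<^sub>R ?f (ln r) =
      indicator {0<..} r *\<^sub>R (exp ((z - 1) * of_real (ln r)) * exp (- of_real r))" for r :: real
    by (cases "r > 0") (auto simp: scaleR_conv_of_real left_diff_distrib exp_diff exp_minus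
        field_simps exp_of_real)
  have "has_bochner_integral (density lborel (\<lambda>r. ennreal (indicator {0<..} r / r))) (\<lambda>r. ?f (ln r)) (Gamma z)"
  proof (rule has_bochner_integral_density)
    show "has_bochner_integral lborel (\<lambda>r. (indicator {0<..} r / r) *\<^sub>R ?f (ln r)) (Gamma z)"
      unfolding eq by (rule has_bochner_integral_Gamma[OF assms])
  qed (auto simp: indicator_def)
  then have "has_bochner_integral (distr (density lborel (\<lambda>r. ennreal (indicator {0<..} r / r))) borel ln) ?f (Gamma z)"
    by (intro has_bochner_integral_distr) auto
  then show ?thesis
    by (simp flip: lborel_eq_distr_ln)
qed

text \<open>The phase of the integrand disappears under the absolute value, and what remains is the
  same integral at the real point \<open>Re z\<close>.\<close>

lemma norm_Gamma_le_Re: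
  assumes "Re z > 0"
  shows "norm (Gamma z) \<le> Gamma (Re z)"
proof -
  have norm_eq: "norm (exp (z * of_real u - of_real (exp u))) = exp (Re z * u - exp u)" for u
    by (simp add: norm_exp_eq_Re)
  have "norm (Gamma z) \<le> (LINT u|lborel. exp (Re z * u - exp u))"
    using has_bochner_integral_Gamma_exp[OF assms]
      integral_norm_bound[of lborel "\<lambda>u. exp (z * of_real u - of_real (exp u))"]
    by (simp add: has_bochner_integral_iff norm_eq)
  also have "complex_of_real (LINT u|lborel. exp (Re z * u - exp u)) = of_real (Gamma (Re z))"
    using has_bochner_integral_Gamma_exp[of "of_real (Re z)"] assms
    by (simp add: has_bochner_integral_iff Gamma_complex_of_real flip: integral_complex_of_real exp_of_real)
  then have "(LINT u|lborel. exp (Re z * u - exp u)) = Gamma (Re z)"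
    using of_real_eq_iff by blast
  finally show ?thesis .
qed

lemma Complex_notin_nonpos_Ints: "a > 0 \<Longrightarrow> Complex a t \<notin> \<int>\<^sub>\<le>\<^sub>0"
  by (auto elim!: nonpos_Ints_cases simp: complex_eq_iff)

lemma norm_Gamma_vertical_le:
  assumes "a > 0"
  shows "norm (Gamma (Complex a t)) \<le> Gamma (a + 2) / (a\<^sup>2 + t\<^sup>2)"
proof -
  define s where "s = Complex a t"
  have ns: "norm s ^ 2 = a\<^sup>2 + t\<^sup>2"
    by (simp add: s_def cmod_power2)
  have pos: "a\<^sup>2 + t\<^sup>2 > 0" using assms by (simp add: sum_power2_gt_zero_iff)
  have s1: "s + 1 = Complex (a + 1) t" by (simp add: s_def complex_eq_iff)
  \<comment> \<open>Moving right from a point with positive real part increases the modulus, so both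
    linear factors are at least \<open>norm s\<close>, which yields quadratic decay in
    \<open>t\<close>.\<close>
  have "norm s \<le> norm (s + 1)"
    using assms unfolding s1 by (simp add: s_def cmod_def power_mono)
  then have le: "norm s ^ 2 \<le> norm (s + 1) * norm s"
    by (simp add: power2_eq_square mult_right_mono)
  have "Gamma (s + 2) = (s + 1) * (s * Gamma s)"
    using Gamma_plus1[of s] Gamma_plus1[of "s + 1"] assms s1
    by (simp add: Complex_notin_nonpos_Ints s_def add.assoc)
  then have "norm (Gamma (s + 2)) = norm (s + 1) * norm s * norm (Gamma s)"
    by (simp add: norm_mult mult.assoc)
  also have "\<dots> \<ge> (a\<^sup>2 + t\<^sup>2) * norm (Gamma s)"
    using le by (intro mult_right_mono) (auto simp: ns)
  finally have "(a\<^sup>2 + t\<^sup>2) * norm (Gamma s) \<le> norm (Gamma (s + 2))" .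
  also have "\<dots> \<le> Gamma (a + 2)"
    using norm_Gamma_le_Re[of "s + 2"] assms by (simp add: s_def)
  finally show ?thesis
    using pos by (simp add: s_def field_simps)
qed

lemma integrable_Gamma_vertical:
  assumes "a > 0"
  shows "integrable lborel (\<lambda>t. Gamma (Complex a t))"
proof (rule Bochner_Integration.integrable_bound)
  have "integrable lborel (\<lambda>t::real. inverse (1 + t\<^sup>2))"
    using integrable_inverse_1_plus_square by (simp add: set_integrable_def)
  then have "integrable lborel (\<lambda>t::real. Gamma (a + 2) / a\<^sup>2 * inverse (1 + (0 + 1 / a * t)\<^sup>2))"
    using assms by (intro integrable_mult_right lborel_integrable_real_affine) auto
  then show "integrable lborel (\<lambda>t. Gamma (a + 2) / (a\<^sup>2 + t\<^sup>2))"
    using assms by (simp add: field_simps)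
  have "continuous_on UNIV (\<lambda>t. Gamma (Complex a t))"
  proof (rule continuous_on_compose2[OF continuous_on_Gamma])
    show "{z. Re z > 0} \<inter> \<int>\<^sub>\<le>\<^sub>0 = {}" by (auto elim!: nonpos_Ints_cases)
    show "continuous_on UNIV (Complex a)"
      unfolding Complex_eq by (intro continuous_intros)
  qed (use assms in auto)
  then show "(\<lambda>t. Gamma (Complex a t)) \<in> borel_measurable lborel"
    by (simp add: borel_measurable_continuous_onI)
  show "AE t in lborel. norm (Gamma (Complex a t)) \<le> norm (Gamma (a + 2) / (a\<^sup>2 + t\<^sup>2))"
    using norm_Gamma_vertical_le[OF assms] by (intro AE_I2) (smt (verit) real_norm_def)
qed

lemma Cahen_Mellin:
  assumes "a > 0" "x > 0"
  shows "(LINT t|lborel. Gamma (Complex a t) * of_real x powr (- Complex a t)) = 2 * pi * exp (- x)"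
proof -
  define h where "h u = complex_of_real (exp (a * u - exp u))" for u
  have eq: "h u * iexp (t * u) = exp (Complex a t * of_real u - of_real (exp u))" for t u
    by (simp add: h_def Complex_eq algebra_simps exp_of_real [symmetric] flip: exp_add)
  have trafo: "(LINT u|lborel. h u * iexp (t * u)) = Gamma (Complex a t)" for t
    unfolding eq using has_bochner_integral_Gamma_exp[of "Complex a t"] assms
    by (simp add: has_bochner_integral_iff)
  have "(LINT t|lborel. (LINT u|lborel. h u * iexp (t * u)) * iexp (- (t * ln x))) = 2 * pi * h (ln x)"
  proof (rule fourier_inversion)
    show "integrable lborel h"
    proof -
      have "h = (\<lambda>u. exp (Complex a 0 * of_real u - of_real (exp u)))"
        using eq[of _ 0] by auto
      then show ?thesis
        using has_bochner_integral_Gamma_exp[of "Complex a 0"] assms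
        by (simp add: has_bochner_integral_iff)
    qed
    show "norm (h u) \<le> exp (a * ln a - a)" for u
    proof -
      \<comment> \<open>The exponent \<open>a * u - exp u\<close> is largest at
        \<open>u = ln a\<close>; this is \<open>exp v >= 1 + v\<close> for
        \<open>v = u - ln a\<close>.\<close>
      have "a * (1 + (u - ln a)) \<le> a * exp (u - ln a)"
        using assms by (intro mult_left_mono exp_ge_add_one_self) auto
      also have "\<dots> = exp u"
        using assms by (simp add: exp_diff)
      finally show ?thesis
        by (simp add: h_def algebra_simps)
    qed
    show "isCont h (ln x)"
      unfolding h_def by (intro continuous_intros)
    show "integrable lborel (\<lambda>t. LINT u|lborel. h u * iexp (t * u))"
      unfolding trafo by (rule integrable_Gamma_vertical[OF assms(1)])
  qed
  \<comment> \<open>Here \<open>h (ln x) = x powr a * exp (- x)\<close>, and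
    \<open>x powr - a\<close>, the modulus of \<open>x powr (- s)\<close> on the line, removes the
    power of \<open>x\<close>.\<close>
  then have "(LINT t|lborel. of_real (x powr - a) * (Gamma (Complex a t) * iexp (- (t * ln x)))) =
      of_real (x powr - a) * (2 * pi * h (ln x))"
    unfolding trafo by simp
  also have "\<dots> = 2 * pi * exp (- x)"
    using assms by (simp add: h_def powr_def exp_diff exp_minus field_simps)
  also have "(\<lambda>t. of_real (x powr - a) * (Gamma (Complex a t) * iexp (- (t * ln x)))) =
      (\<lambda>t. Gamma (Complex a t) * of_real x powr (- Complex a t))"
  proof
    fix t
    have "of_real x powr (- Complex a t) = of_real (x powr - a) * iexp (- (t * ln x))"
      using assms by (simp add: powr_def Ln_of_real Complex_eq exp_of_real [symmetric]
          algebra_simps flip: exp_add)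
    then show "of_real (x powr - a) * (Gamma (Complex a t) * iexp (- (t * ln x))) =
      Gamma (Complex a t) * of_real x powr (- Complex a t)" by simp
  qed
  finally show ?thesis .
qed

subsection \<open>Multiplicative convolutions of radial functions\<close>

text \<open>The indicator makes \<^term>\<open>mellin_kernel s 0\<close> vanish like \<open>f / 0\<close>, so that the identities below hold
  at every point, including those with a vanishing coordinate.\<close>
definition mellin_kernel :: "complex \<Rightarrow> real \<Rightarrow> complex" where
  "mellin_kernel s r = indicator {0<..} r *\<^sub>R (exp ((s - 1) * of_real (ln r)) * exp (- of_real r))"

lemma measurable_mellin_kernel [measurable]: "mellin_kernel s \<in> borel_measurable borel"
  unfolding mellin_kernel_def by measurable

text \<open>Integrating out the angle costs one factor \<open>pi\<close>; the \<open>n - 1\<close>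
  variables together produce the \<open>pi ^ (n - 1)\<close> of the later identities.\<close>

lemma has_bochner_integral_mellin_kernel_cmod:
  fixes s :: complex
  assumes "Re s > 0"
  shows "has_bochner_integral lborel (\<lambda>z::complex. mellin_kernel s ((norm z)\<^sup>2)) (pi * Gamma s)"
proof -
  have eq: "indicator {0<..} r *\<^sub>R mellin_kernel s r = mellin_kernel s r" for r
    by (simp add: mellin_kernel_def indicator_def)
  have "has_bochner_integral lborel (mellin_kernel s) (Gamma s)"
    unfolding mellin_kernel_def by (rule has_bochner_integral_Gamma[OF assms])
  then show ?thesis
    using has_bochner_integral_cmod_squared[OF measurable_mellin_kernel, of s "Gamma s"]
    unfolding eq by (simp add: scaleR_conv_of_real)
qed

text \<open>The argument \<open>x\<close> and the arguments of the factors \<open>e j\<close> are squared moduli.\<close>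
definition radial_conv :: "(nat \<Rightarrow> real \<Rightarrow> real) \<Rightarrow> nat \<Rightarrow> real \<Rightarrow> real" where
  "radial_conv e n x = (LINT y | PiM {2..n} (\<lambda>_. lborel :: complex measure).
     e 1 (x / (\<Prod>j=2..n. (norm (y j))\<^sup>2)) * (\<Prod>j=2..n. e j ((norm (y j))\<^sup>2) / (norm (y j))\<^sup>2))"

text \<open>A Mellin transform turns a multiplicative convolution into a product. Inside the contour
  integral for the first factor, \<open>(x / p) powr (- s)\<close> splits into
  \<open>x powr (- s)\<close> and one power of \<open>|y j|^2\<close> per remaining variable, so the
  integrals over the \<open>y j\<close> separate into Gamma values.\<close>

lemma radial_conv_exp_eq_Mellin_Barnes:
  fixes \<nu> :: "nat \<Rightarrow> nat"
  assumes n: "n \<ge> 1" and \<nu>1: "\<nu> 1 = 0" and a: "a > 0" and x: "x > 0"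
  shows "(LINT t|lborel. (\<Prod>j=1..n. Gamma (of_nat (\<nu> j) + Complex a t)) * of_real x powr (- Complex a t)) =
    of_real (2 * pi / pi ^ (n - 1) * radial_conv (\<lambda>j u. u ^ \<nu> j * exp (- u)) n x)"
proof -
  let ?P = "PiM {2..n} (\<lambda>_. lborel :: complex measure)"
  interpret product_sigma_finite "\<lambda>_::nat. lborel :: complex measure" ..
  interpret finite_product_sigma_finite "\<lambda>_::nat. lborel :: complex measure" "{2..n}"
    by standard auto
  interpret P: pair_sigma_finite ?P "lborel :: real measure" ..
  \<comment> \<open>\<open>K s\<close> collects the variables \<open>2..n\<close> together with
    their share of \<open>p powr s\<close>; \<open>E s\<close> is the part contributed by the first
    factor.\<close>
  define K where "K s y = (\<Prod>j=2..n. mellin_kernel (of_nat (\<nu> j) + s) ((norm (y j))\<^sup>2))"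
    for s and y :: "nat \<Rightarrow> complex"
  define E where "E s = Gamma s * of_real x powr (- s)" for s :: complex
  have K_int: "has_bochner_integral ?P (K s) (\<Prod>j=2..n. pi * Gamma (of_nat (\<nu> j) + s))" if "Re s > 0" for s :: complex
  proof -
    have "has_bochner_integral lborel (\<lambda>z::complex. mellin_kernel (of_nat (\<nu> j) + s) ((norm z)\<^sup>2))
        (pi * Gamma (of_nat (\<nu> j) + s))" for j
      using that by (intro has_bochner_integral_mellin_kernel_cmod) (simp add: add_nonneg_pos)
    then show ?thesis
      unfolding K_def has_bochner_integral_iff
      using product_integrable_prod[of "{2..n}" "\<lambda>j z. mellin_kernel (of_nat (\<nu> j) + s) ((norm z)\<^sup>2)"]
        product_integral_prod[of "{2..n}" "\<lambda>j z. mellin_kernel (of_nat (\<nu> j) + s) ((norm z)\<^sup>2)"]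
      by simp
  qed
  have x_powr: "of_real x powr (- Complex a t) = of_real (x powr - a) * iexp (- (t * ln x))" for t
    using x by (simp add: powr_def Ln_of_real Complex_eq exp_of_real [symmetric]
          algebra_simps flip: exp_add)
  \<comment> \<open>On the vertical line \<open>t\<close> enters \<open>K\<close> only through a
    phase, so a majorant for \<open>K\<close> independent of \<open>t\<close> is available.\<close>
  have K_t: "K (Complex a t) y = K (of_real a) y * iexp (t * (\<Sum>j=2..n. ln ((norm (y j))\<^sup>2)))" for t y
  proof -
    have "mellin_kernel (of_nat m + Complex a t) r = mellin_kernel (of_nat m + of_real a) r * iexp (t * ln r)" for m r
      by (simp add: mellin_kernel_def Complex_eq algebra_simps flip: exp_add)
    then have "K (Complex a t) y = K (of_real a) y * (\<Prod>j=2..n. iexp (t * ln ((norm (y j))\<^sup>2)))"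
      by (simp add: K_def prod.distrib)
    then show ?thesis
      by (simp add: sum_distrib_left exp_sum)
  qed
  have [measurable]: "K s \<in> borel_measurable ?P" for s
    unfolding K_def by measurable
  have "integrable (?P \<Otimes>\<^sub>M lborel) (\<lambda>(y, t). K (of_real a) y * (Gamma (Complex a t) * of_real (x powr - a)) *
      (\<lambda>(y, t). iexp (- (t * ln x)) * iexp (t * (\<Sum>j=2..n. ln ((norm (y j))\<^sup>2)))) (y, t))"
  proof (rule P.integrable_mult_bounded)
    show "integrable ?P (K (of_real a))"
      using K_int[of "of_real a"] a by (simp add: has_bochner_integral_iff)
    show "integrable lborel (\<lambda>t. Gamma (Complex a t) * of_real (x powr - a))"
      using integrable_Gamma_vertical[OF a] by simp
  qed (auto simp: norm_mult)
  then have int: "integrable (?P \<Otimes>\<^sub>M lborel) (\<lambda>(y, t). E (Complex a t) * K (Complex a t) y)"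
    by (simp add: E_def x_powr K_t mult_ac)
  have inner: "of_real (exp (- (x / (\<Prod>j=2..n. (norm (y j))\<^sup>2))) *
        (\<Prod>j=2..n. ((norm (y j))\<^sup>2) ^ \<nu> j * exp (- (norm (y j))\<^sup>2) / (norm (y j))\<^sup>2)) =
      1 / (2 * pi) * (LINT t|lborel. E (Complex a t) * K (Complex a t) y)" for y
  proof (cases "\<exists>j\<in>{2..n}. y j = 0")
    \<comment> \<open>Both sides are 0: on the left by division by 0, on the right by the indicator
      in \<open>mellin_kernel\<close>.\<close>
    case True
    then have "K s y = 0" for s
      unfolding K_def by (intro prod_zero) (force simp: mellin_kernel_def indicator_eq_0_iff)+
    moreover have "(\<Prod>j=2..n. ((norm (y j))\<^sup>2) ^ \<nu> j * exp (- (norm (y j))\<^sup>2) / (norm (y j))\<^sup>2) = 0"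
      using True by auto
    ultimately show ?thesis by simp
  next
    case False
    define p where "p = (\<Prod>j=2..n. (norm (y j))\<^sup>2)"
    have p: "p > 0" using False unfolding p_def by (intro prod_pos) auto
    define C where "C = complex_of_real (\<Prod>j=2..n. ((norm (y j))\<^sup>2) ^ \<nu> j * exp (- (norm (y j))\<^sup>2) / (norm (y j))\<^sup>2)"
    have K_eq: "K s y = of_real p powr s * C" for s
    proof -
      have "mellin_kernel (of_nat m + s) r = of_real r powr s * of_real (r ^ m * exp (- r) / r)"
        if "r > 0" for m r
      proof -
        have "exp (of_nat m * complex_of_real (ln r)) = of_real r ^ m"
          using that by (simp add: exp_of_nat_mult exp_of_real)
        then show ?thesis
          using that by (simp add: mellin_kernel_def powr_def Ln_of_real algebra_simps exp_diff exp_add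
            exp_of_real exp_minus field_simps)
      qed
      then have "K s y = (\<Prod>j=2..n. of_real ((norm (y j))\<^sup>2) powr s *
          of_real ((((norm (y j))\<^sup>2) ^ \<nu> j * exp (- (norm (y j))\<^sup>2) / (norm (y j))\<^sup>2)))"
        using False unfolding K_def by (intro prod.cong) auto
      also have "\<dots> = (\<Prod>j=2..n. of_real ((norm (y j))\<^sup>2) powr s) * C"
        by (simp add: prod.distrib C_def prod_dividef)
      also have "(\<Prod>j=2..n. complex_of_real ((norm (y j))\<^sup>2) powr s) = of_real p powr s"
      proof -
        have "(\<Prod>j=2..n. complex_of_real ((norm (y j))\<^sup>2) powr s) =
            (\<Prod>j=2..n. exp (s * of_real (ln ((norm (y j))\<^sup>2))))"
          using False by (intro prod.cong) (auto simp: powr_def Ln_of_real simp del: of_real_power)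
        also have "\<dots> = exp (s * of_real (ln p))"
        proof -
          have "ln p = (\<Sum>j=2..n. ln ((norm (y j))\<^sup>2))"
            unfolding p_def using False by (intro ln_prod) auto
          then show ?thesis
            by (simp add: sum_distrib_left exp_sum)
        qed
        also have "\<dots> = of_real p powr s"
          using p by (simp add: powr_def Ln_of_real)
        finally show ?thesis .
      qed
      finally show ?thesis .
    qed
    have E_eq: "E s * K s y = C * (Gamma s * of_real (x / p) powr (- s))" for s
      using x p by (simp add: E_def K_eq powr_def Ln_of_real ln_div algebra_simps
          del: of_real_divide flip: exp_add)
    have "(LINT t|lborel. E (Complex a t) * K (Complex a t) y) = C * (2 * pi * exp (- (x / p)))"
      unfolding E_eq using x p Cahen_Mellin[OF a, of "x / p"]
      by (simp only: integral_mult_right_zero divide_pos_pos)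
    then show ?thesis
      by (simp add: C_def p_def)
  qed
  have "of_real (radial_conv (\<lambda>j u. u ^ \<nu> j * exp (- u)) n x) =
     (LINT y|?P. 1 / (2 * pi) * (LINT t|lborel. E (Complex a t) * K (Complex a t) y))"
    unfolding radial_conv_def inner[symmetric] integral_complex_of_real \<nu>1 by simp
  also have "\<dots> = 1 / (2 * pi) * (LINT t|lborel. LINT y|?P. E (Complex a t) * K (Complex a t) y)"
    by (subst P.Fubini_integral[OF int]) (rule integral_mult_right_zero)
  also have "\<dots> = 1 / (2 * pi) * (LINT t|lborel. of_real (pi ^ (n - 1)) *
     ((\<Prod>j=1..n. Gamma (of_nat (\<nu> j) + Complex a t)) * of_real x powr (- Complex a t)))"
  proof -
    have "(LINT y|?P. E (Complex a t) * K (Complex a t) y) = of_real (pi ^ (n - 1)) *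
     ((\<Prod>j=1..n. Gamma (of_nat (\<nu> j) + Complex a t)) * of_real x powr (- Complex a t))" for t
    proof -
      \<comment> \<open>The index 1 is the factor \<open>Gamma s\<close> inside \<open>E\<close>,
        because \<open>\<nu> 1 = 0\<close>; every other index contributes a \<open>pi\<close> as
        well.\<close>
      have "{1..n} = insert 1 {2..n}" using n by auto
      then have "(\<Prod>j=1..n. Gamma (of_nat (\<nu> j) + Complex a t)) =
          Gamma (Complex a t) * (\<Prod>j=2..n. Gamma (of_nat (\<nu> j) + Complex a t))"
        using \<nu>1 by simp
      then show ?thesis
        using K_int[of "Complex a t"] a
        by (simp add: E_def has_bochner_integral_iff prod.distrib Suc_diff_Suc numeral_2_eq_2)
    qed
    then show ?thesis by simp
  qed
  also have "\<dots> = of_real (pi ^ (n - 1) / (2 * pi)) *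
      (LINT t|lborel. (\<Prod>j=1..n. Gamma (of_nat (\<nu> j) + Complex a t)) * of_real x powr (- Complex a t))"
    by (subst integral_mult_right_zero) simp
  finally show ?thesis by (simp add: field_simps)
qed

section \<open>Behaviour of the convolution under scaling\<close>

text \<open>Scaling by \<open>c\<close> multiplies area in the complex plane by \<open>c^2\<close>,
  once per index; measurable boxes suffice to identify a product measure.\<close>

lemma lborel_PiM_scaleR:
  fixes c :: real
  assumes I: "finite I" and c: "c > 0"
  shows "PiM I (\<lambda>_. lborel :: complex measure) =
    density (distr (PiM I (\<lambda>_. lborel)) (PiM I (\<lambda>_. lborel)) (\<lambda>y. \<lambda>i\<in>I. c *\<^sub>R y i)) (\<lambda>_. ennreal ((c\<^sup>2) ^ card I))"
proof (rule sym)
  interpret product_sigma_finite "\<lambda>_. lborel :: complex measure" ..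
  let ?P = "PiM I (\<lambda>_. lborel :: complex measure)"
  show "density (distr ?P ?P (\<lambda>y. \<lambda>i\<in>I. c *\<^sub>R y i)) (\<lambda>_. ennreal ((c\<^sup>2) ^ card I)) = ?P"
  proof (rule PiM_eqI[OF I])
    fix A :: "_ \<Rightarrow> complex set"
    assume "\<And>i. i \<in> I \<Longrightarrow> A i \<in> sets lborel"
    then have A: "A i \<in> sets borel" if "i \<in> I" for i using that by simp
    have pre: "(\<lambda>z. c *\<^sub>R z) -` A i \<in> sets borel" if "i \<in> I" for i
      using measurable_sets_borel[of "\<lambda>z. c *\<^sub>R z" borel, OF _ A[OF that]] by simp
    have "emeasure lborel (A i) = ennreal (c\<^sup>2) * emeasure lborel ((\<lambda>z. c *\<^sub>R z) -` A i)" if "i \<in> I" for i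
    proof -
      have "emeasure lborel (A i) = emeasure (density (distr lborel borel (\<lambda>x. 0 + c *\<^sub>R x)) (\<lambda>_. \<bar>c\<bar>^DIM(complex))) (A i)"
        using c by (subst lborel_affine[of c 0]) auto
      also have "\<dots> = ennreal (c\<^sup>2) * emeasure (distr lborel borel (\<lambda>x. c *\<^sub>R x)) (A i)"
        using A[OF that] c by (subst emeasure_density_const) (auto simp: power2_eq_square)
      also have "emeasure (distr lborel borel (\<lambda>x. c *\<^sub>R x)) (A i) = emeasure lborel ((\<lambda>z. c *\<^sub>R z) -` A i)"
        using A[OF that] by (subst emeasure_distr) auto
      finally show ?thesis .
    qed
    then have "(\<Prod>i\<in>I. emeasure lborel (A i)) =
        ennreal ((c\<^sup>2) ^ card I) * (\<Prod>i\<in>I. emeasure lborel ((\<lambda>z. c *\<^sub>R z) -` A i))"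
      by (simp add: prod.distrib ennreal_power)
    also have "(\<Prod>i\<in>I. emeasure lborel ((\<lambda>z. c *\<^sub>R z) -` A i)) = emeasure ?P (PiE I (\<lambda>i. (\<lambda>z. c *\<^sub>R z) -` A i))"
      using pre I by (intro emeasure_PiM[symmetric]) auto
    also have "PiE I (\<lambda>i. (\<lambda>z. c *\<^sub>R z) -` A i) = (\<lambda>y. \<lambda>i\<in>I. c *\<^sub>R y i) -` PiE I A \<inter> space ?P"
      by (auto simp: space_PiM PiE_iff)
    also have "emeasure ?P \<dots> = emeasure (distr ?P ?P (\<lambda>y. \<lambda>i\<in>I. c *\<^sub>R y i)) (PiE I A)"
      using A I by (intro emeasure_distr[symmetric]) (auto intro!: sets_PiM_I_finite)
    also have "ennreal ((c\<^sup>2) ^ card I) * \<dots> =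
        emeasure (density (distr ?P ?P (\<lambda>y. \<lambda>i\<in>I. c *\<^sub>R y i)) (\<lambda>_. ennreal ((c\<^sup>2) ^ card I))) (PiE I A)"
      using A I by (intro emeasure_density_const[symmetric]) (auto intro!: sets_PiM_I_finite)
    finally show "emeasure (density (distr ?P ?P (\<lambda>y. \<lambda>i\<in>I. c *\<^sub>R y i)) (\<lambda>_. ennreal ((c\<^sup>2) ^ card I))) (PiE I A)
      = (\<Prod>i\<in>I. emeasure lborel (A i))" ..
  qed simp
qed

lemma measurable_radial_conv_integrand:
  assumes [measurable]: "\<And>j. e j \<in> borel_measurable borel"
  shows "(\<lambda>y. e 1 (x / (\<Prod>j=2..n. (norm (y j))\<^sup>2)) * (\<Prod>j=2..n. e j ((norm (y j))\<^sup>2) / (norm (y j))\<^sup>2))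
    \<in> borel_measurable (PiM {2..n} (\<lambda>_. lborel :: complex measure))"
  by measurable

text \<open>The measure \<open>dy / |y|^2\<close> is scale invariant. Multiplying the
  \<open>n - 1\<close> variables by \<open>1 / sqrt q\<close> absorbs all but one of the powers in
  \<open>q ^ n\<close>, and the last one lands in the first factor.\<close>

lemma radial_conv_scale:
  assumes e: "\<And>j. e j \<in> borel_measurable borel" and q: "q > 0" and n: "n \<ge> 1"
  shows "radial_conv e n (x / q ^ n) = radial_conv (\<lambda>j u. e j (u / q)) n x"
proof -
  let ?P = "PiM {2..n} (\<lambda>_. lborel :: complex measure)"
  define c where "c = 1 / sqrt q"
  have c: "c > 0" and c2: "c\<^sup>2 = 1 / q" using q by (auto simp: c_def power_divide)
  let ?f = "\<lambda>y. e 1 (x / q ^ n / (\<Prod>j=2..n. (norm (y j))\<^sup>2)) * (\<Prod>j=2..n. e j ((norm (y j))\<^sup>2) / (norm (y j))\<^sup>2)"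
  have "radial_conv e n (x / q ^ n) = integral\<^sup>L (density (distr ?P ?P (\<lambda>y. \<lambda>i\<in>{2..n}. c *\<^sub>R y i))
      (\<lambda>_. ennreal ((c\<^sup>2) ^ card {2..n}))) ?f"
    unfolding radial_conv_def using c by (subst lborel_PiM_scaleR[of _ c]) auto
  also have "\<dots> = (LINT y|?P. (c\<^sup>2) ^ card {2..n} *\<^sub>R ?f (\<lambda>i\<in>{2..n}. c *\<^sub>R y i))"
  proof -
    have [measurable]: "(\<lambda>y. \<lambda>i\<in>{2..n}. c *\<^sub>R y i) \<in> measurable ?P ?P"
      by measurable
    have "integral\<^sup>L (density (distr ?P ?P (\<lambda>y. \<lambda>i\<in>{2..n}. c *\<^sub>R y i))
        (\<lambda>_. ennreal ((c\<^sup>2) ^ card {2..n}))) ?f =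
      (LINT y|distr ?P ?P (\<lambda>y. \<lambda>i\<in>{2..n}. c *\<^sub>R y i). (c\<^sup>2) ^ card {2..n} *\<^sub>R ?f y)"
      using measurable_radial_conv_integrand[where e = e, OF e, of "x / q ^ n" n]
      by (intro integral_density) auto
    also have "\<dots> = (LINT y|?P. (c\<^sup>2) ^ card {2..n} *\<^sub>R ?f (\<lambda>i\<in>{2..n}. c *\<^sub>R y i))"
      using measurable_radial_conv_integrand[where e = e, OF e, of "x / q ^ n" n]
      by (intro integral_distr borel_measurable_scaleR) auto
    finally show ?thesis .
  qed
  also have "\<dots> = radial_conv (\<lambda>j u. e j (u / q)) n x"
    unfolding radial_conv_def
  proof (intro Bochner_Integration.integral_cong refl)
    fix y :: "nat \<Rightarrow> complex"
    have card: "card {2..n} = n - 1" using n by simp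
    have 1: "(\<Prod>j=2..n. (norm ((\<lambda>i\<in>{2..n}. c *\<^sub>R y i) j))\<^sup>2) = (\<Prod>j=2..n. (norm (y j))\<^sup>2) / q ^ (n - 1)"
    proof -
      have "(\<Prod>j=2..n. (norm ((\<lambda>i\<in>{2..n}. c *\<^sub>R y i) j))\<^sup>2) = (\<Prod>j=2..n. (norm (y j))\<^sup>2 / q)"
        by (intro prod.cong) (auto simp: power_mult_distrib c2)
      then show ?thesis by (simp add: prod_dividef card)
    qed
    have 2: "(\<Prod>j=2..n. e j ((norm ((\<lambda>i\<in>{2..n}. c *\<^sub>R y i) j))\<^sup>2) / (norm ((\<lambda>i\<in>{2..n}. c *\<^sub>R y i) j))\<^sup>2) =
       q ^ (n - 1) * (\<Prod>j=2..n. e j ((norm (y j))\<^sup>2 / q) / (norm (y j))\<^sup>2)"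
    proof -
      have "(\<Prod>j=2..n. e j ((norm ((\<lambda>i\<in>{2..n}. c *\<^sub>R y i) j))\<^sup>2) / (norm ((\<lambda>i\<in>{2..n}. c *\<^sub>R y i) j))\<^sup>2) =
        (\<Prod>j=2..n. q * (e j ((norm (y j))\<^sup>2 / q) / (norm (y j))\<^sup>2))"
        by (intro prod.cong) (auto simp: power_mult_distrib c2)
      then show ?thesis by (simp add: prod.distrib card del: times_divide_eq_right)
    qed
    have 3: "x / q ^ n / (p / q ^ (n - 1)) = x / p / q" for p
      using q n by (cases n) (auto simp: field_simps)
    show "(c\<^sup>2) ^ card {2..n} *\<^sub>R ?f (\<lambda>i\<in>{2..n}. c *\<^sub>R y i) =
      e 1 (x / (\<Prod>j=2..n. (norm (y j))\<^sup>2) / q) * (\<Prod>j=2..n. e j ((norm (y j))\<^sup>2 / q) / (norm (y j))\<^sup>2)"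
      unfolding 1 2 3 card using q by (simp add: c2 power_divide)
  qed
  finally show ?thesis .
qed

lemma product_weight_eq_radial_conv:
  "product_weight \<nu> n N z = radial_conv (\<lambda>j u. u ^ \<nu> j / (1 + u) ^ (\<nu> j + N + 1)) n ((norm z)\<^sup>2)"
  unfolding product_weight_def radial_conv_def
proof (intro Bochner_Integration.integral_cong refl)
  fix x :: "nat \<Rightarrow> complex"
  have p: "(norm (\<Prod>j=2..n. x j))\<^sup>2 = (\<Prod>j=2..n. (norm (x j))\<^sup>2)"
    by (simp add: prod_norm[symmetric] prod_power_distrib)
  have f: "factor_weight m N w = ((norm w)\<^sup>2) ^ m / (1 + (norm w)\<^sup>2) ^ (m + N + 1)" for m w
    by (simp add: factor_weight_def power_mult)
  show "factor_weight (\<nu> 1) N (z / (\<Prod>j=2..n. x j)) * (\<Prod>j=2..n. factor_weight (\<nu> j) N (x j)) /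
      (norm (\<Prod>j=2..n. x j))\<^sup>2 =
    ((norm z)\<^sup>2 / (\<Prod>j=2..n. (norm (x j))\<^sup>2)) ^ \<nu> 1 /
      (1 + (norm z)\<^sup>2 / (\<Prod>j=2..n. (norm (x j))\<^sup>2)) ^ (\<nu> 1 + N + 1) *
    (\<Prod>j=2..n. ((norm (x j))\<^sup>2) ^ \<nu> j / (1 + (norm (x j))\<^sup>2) ^ (\<nu> j + N + 1) / (norm (x j))\<^sup>2)"
    by (subst prod_dividef) (simp only: f norm_divide power_divide p times_divide_eq_right)
qed

subsection \<open>Continuous convergence\<close>

text \<open>If no neighbourhood worked, there would be bad pairs of an index and a point at distance
  below \<open>1 / (k + 1)\<close>; arranged with increasing indices they contradict
  \<open>conv\<close>.\<close>

lemma continuous_convergence_nhd: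
  fixes f :: "nat \<Rightarrow> 'a::metric_space \<Rightarrow> 'b::metric_space"
  assumes conv: "\<And>\<phi> X. strict_mono \<phi> \<Longrightarrow> (\<And>k. X k \<in> S) \<Longrightarrow> X \<longlonglongrightarrow> x \<Longrightarrow> (\<lambda>k. f (\<phi> k) (X k)) \<longlonglongrightarrow> L"
    and e: "e > 0"
  shows "\<exists>d>0. \<exists>M. \<forall>N\<ge>M. \<forall>y\<in>S. dist y x < d \<longrightarrow> dist (f N y) L < e"
proof (rule ccontr)
  assume "\<not> ?thesis"
  then have ex: "\<exists>N\<ge>M. \<exists>y\<in>S. dist y x < d \<and> \<not> dist (f N y) L < e" if "d > 0" for d M
    using that by blast
  let ?P = "\<lambda>k (N, y). y \<in> S \<and> dist y x < 1 / real (Suc k) \<and> \<not> dist (f N y) L < e"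
  \<comment> \<open>Dependent choice makes the indices strictly increasing, as \<open>conv\<close>
    asks of \<open>\<phi>\<close>.\<close>
  have "\<exists>h. \<forall>k. ?P k (h k) \<and> fst (h k) < fst (h (Suc k))"
  proof (rule dependent_nat_choice)
    show "\<exists>p. ?P 0 p"
      using ex[of 1 0] by auto
    show "\<exists>q. ?P (Suc k) q \<and> fst p < fst q" for p k
      using ex[of "1 / real (Suc (Suc k))" "Suc (fst p)"] by fastforce
  qed
  then obtain h where "\<forall>k. ?P k (h k) \<and> fst (h k) < fst (h (Suc k))" ..
  then have h: "\<And>k. ?P k (h k)" "\<And>k. fst (h k) < fst (h (Suc k))"
    by simp_all
  define \<phi> X where "\<phi> k = fst (h k)" and "X k = snd (h k)" for k
  have X: "X k \<in> S" "dist (X k) x < 1 / real (Suc k)" "\<not> dist (f (\<phi> k) (X k)) L < e" for k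
    using h(1)[of k] by (auto simp: \<phi>_def X_def split_beta)
  have "strict_mono \<phi>"
    using h(2) by (simp add: strict_mono_Suc_iff \<phi>_def)
  moreover have "X \<longlonglongrightarrow> x"
  proof (rule tendstoI)
    fix r :: real assume "r > 0"
    then have "eventually (\<lambda>k. 1 / real (Suc k) < r) sequentially"
      using order_tendstoD(2)[OF LIMSEQ_Suc[OF lim_1_over_n]] by auto
    then show "eventually (\<lambda>k. dist (X k) x < r) sequentially"
      by eventually_elim (use X(2) less_trans in blast)
  qed
  ultimately have "(\<lambda>k. f (\<phi> k) (X k)) \<longlonglongrightarrow> L"
    using conv X(1) by blast
  then have "eventually (\<lambda>k. dist (f (\<phi> k) (X k)) L < e) sequentially"
    using e by (rule tendstoD)
  then show False
    using X(3) by simp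
qed

text \<open>A constant sequence at a nearby \<open>y\<close> shows that \<open>g y\<close> is within
  \<open>e / 2\<close> of some \<open>f k y\<close>, which is itself within \<open>e / 2\<close> of
  \<open>g x\<close>. So \<open>g\<close> inherits the closeness of the \<open>f N\<close>.\<close>

lemma continuous_convergence_dist_limit:
  fixes f :: "nat \<Rightarrow> 'a::metric_space \<Rightarrow> 'b::metric_space"
  assumes conv: "\<And>\<phi> X x. strict_mono \<phi> \<Longrightarrow> (\<And>k. X k \<in> S) \<Longrightarrow> X \<longlonglongrightarrow> x \<Longrightarrow> x \<in> S \<Longrightarrow>
      (\<lambda>k. f (\<phi> k) (X k)) \<longlonglongrightarrow> g x"
    and x: "x \<in> S" and e: "e > 0"
  shows "\<exists>d>0. \<exists>M. \<forall>y\<in>S. dist y x < d \<longrightarrow> dist (g y) (g x) < e \<and> (\<forall>N\<ge>M. dist (f N y) (g x) < e)"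
proof -
  have "\<exists>d>0. \<exists>M. \<forall>N\<ge>M. \<forall>y\<in>S. dist y x < d \<longrightarrow> dist (f N y) (g x) < e / 2"
  proof (rule continuous_convergence_nhd)
    show "(\<lambda>k. f (\<phi> k) (X k)) \<longlonglongrightarrow> g x"
      if "strict_mono \<phi>" "\<And>k. X k \<in> S" "X \<longlonglongrightarrow> x" for \<phi> X
      using that x by (rule conv)
  qed (use e in simp)
  then obtain d M where d: "d > 0"
    and M: "\<And>N y. N \<ge> M \<Longrightarrow> y \<in> S \<Longrightarrow> dist y x < d \<Longrightarrow> dist (f N y) (g x) < e / 2"
    by blast
  have "dist (g y) (g x) < e" if y: "y \<in> S" "dist y x < d" for y
  proof -
    have "(\<lambda>k. f k y) \<longlonglongrightarrow> g y"
      using conv[of id "\<lambda>_. y" y] y by (simp add: strict_mono_def)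
    then have "eventually (\<lambda>k. dist (f k y) (g y) < e / 2) sequentially"
      using e by (intro tendstoD) auto
    then obtain k where "k \<ge> M" "dist (f k y) (g y) < e / 2"
      using eventually_happens[OF eventually_conj[OF _ eventually_ge_at_top[of M]]] by fastforce
    then show ?thesis
      using M[of k y] y by (meson dist_triangle_half_r)
  qed
  moreover have "dist (f N y) (g x) < e" if "N \<ge> M" "y \<in> S" "dist y x < d" for N y
    using M[OF that] e by linarith
  ultimately show ?thesis using d by blast
qed

lemma tendsto_limit_of_continuous_convergence:
  fixes f :: "nat \<Rightarrow> 'a::metric_space \<Rightarrow> 'b::metric_space"
  assumes conv: "\<And>\<phi> X x. strict_mono \<phi> \<Longrightarrow> (\<And>k. X k \<in> S) \<Longrightarrow> X \<longlonglongrightarrow> x \<Longrightarrow> x \<in> S \<Longrightarrow>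
      (\<lambda>k. f (\<phi> k) (X k)) \<longlonglongrightarrow> g x"
    and x: "x \<in> S"
  shows "(g \<longlongrightarrow> g x) (at x within S)"
proof (rule tendstoI)
  fix e :: real assume "e > 0"
  have "\<exists>d>0. \<exists>M. \<forall>y\<in>S. dist y x < d \<longrightarrow> dist (g y) (g x) < e \<and> (\<forall>N\<ge>M. dist (f N y) (g x) < e)"
    by (rule continuous_convergence_dist_limit[OF _ x \<open>e > 0\<close>]) (rule conv)
  then show "eventually (\<lambda>y. dist (g y) (g x) < e) (at x within S)"
    unfolding eventually_at by blast
qed

text \<open>A finite subcover provides one index for all points: if \<open>x\<close> is the centre
  of a ball containing \<open>y\<close>, both \<open>f n y\<close> and \<open>g y\<close> lie within
  \<open>e / 2\<close> of \<open>g x\<close>.\<close>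

lemma uniform_limit_of_continuous_convergence:
  fixes f :: "nat \<Rightarrow> 'a::metric_space \<Rightarrow> 'b::metric_space"
  assumes S: "compact S"
    and conv: "\<And>\<phi> X x. strict_mono \<phi> \<Longrightarrow> (\<And>k. X k \<in> S) \<Longrightarrow> X \<longlonglongrightarrow> x \<Longrightarrow> x \<in> S \<Longrightarrow>
      (\<lambda>k. f (\<phi> k) (X k)) \<longlonglongrightarrow> g x"
  shows "uniform_limit S f g sequentially"
  unfolding uniform_limit_sequentially_iff
proof (intro allI impI)
  fix e :: real assume e: "e > 0"
  have "\<forall>x\<in>S. \<exists>d>0. \<exists>M. \<forall>y\<in>S. dist y x < d \<longrightarrow>
      dist (g y) (g x) < e / 2 \<and> (\<forall>N\<ge>M. dist (f N y) (g x) < e / 2)"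
  proof
    fix x assume "x \<in> S"
    then show "\<exists>d>0. \<exists>M. \<forall>y\<in>S. dist y x < d \<longrightarrow>
        dist (g y) (g x) < e / 2 \<and> (\<forall>N\<ge>M. dist (f N y) (g x) < e / 2)"
      using half_gt_zero[OF e] by (rule continuous_convergence_dist_limit[rotated]) (rule conv)
  qed
  from bchoice[OF this] obtain d where d: "\<forall>x\<in>S. d x > 0 \<and> (\<exists>M. \<forall>y\<in>S. dist y x < d x \<longrightarrow>
      dist (g y) (g x) < e / 2 \<and> (\<forall>N\<ge>M. dist (f N y) (g x) < e / 2))" ..
  then have "\<forall>x\<in>S. \<exists>M. \<forall>y\<in>S. dist y x < d x \<longrightarrow>
      dist (g y) (g x) < e / 2 \<and> (\<forall>N\<ge>M. dist (f N y) (g x) < e / 2)" by blast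
  from bchoice[OF this] obtain M where M: "\<forall>x\<in>S. \<forall>y\<in>S. dist y x < d x \<longrightarrow>
      dist (g y) (g x) < e / 2 \<and> (\<forall>N\<ge>M x. dist (f N y) (g x) < e / 2)" ..
  have "S \<subseteq> (\<Union>x\<in>S. ball x (d x))" using d by force
  then obtain D where D: "D \<subseteq> S" "finite D" "S \<subseteq> (\<Union>x\<in>D. ball x (d x))"
    using compactE_image[OF S, of S "\<lambda>x. ball x (d x)"] by auto
  show "\<exists>N. \<forall>n\<ge>N. \<forall>x\<in>S. dist (f n x) (g x) < e"
  proof (intro exI allI impI ballI)
    fix n y assume n: "n \<ge> Max (M ` D)" and y: "y \<in> S"
    then obtain x where x: "x \<in> D" "dist y x < d x"
      using D(3) by (auto simp: dist_commute)
    have "M x \<le> n"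
      using n x D(2) by (meson Max_ge finite_imageI imageI order_trans)
    then have "dist (g y) (g x) < e / 2" "dist (f n y) (g x) < e / 2"
      using M x y D(1) by blast+
    then show "dist (f n y) (g y) < e"
      by (meson dist_triangle_half_l)
  qed
qed

subsection \<open>Limits of the weight and of the kernel\<close>

text \<open>After taking logarithms, \<open>v - v^2 <= ln (1 + v) <= v\<close> with
  \<open>v = u k / N k\<close> squeezes the exponent; multiplied by \<open>N k\<close>, the error
  \<open>u k * v\<close> still tends to 0.\<close>

lemma tendsto_one_plus_divide_power:
  fixes u :: "'a \<Rightarrow> real" and N :: "'a \<Rightarrow> nat"
  assumes u: "(u \<longlongrightarrow> u0) F" and N: "filterlim N at_top F" and pos: "\<And>k. u k \<ge> 0"
  shows "((\<lambda>k. (1 + u k / N k) ^ N k) \<longlongrightarrow> exp u0) F"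
proof -
  have N': "filterlim (\<lambda>k. real (N k)) at_top F"
    by (rule filterlim_compose[OF filterlim_real_sequentially N])
  have u0: "((\<lambda>k. u k / N k) \<longlongrightarrow> 0) F"
    by (rule real_tendsto_divide_at_top[OF u N'])
  have ev: "eventually (\<lambda>k. N k > 0 \<and> u k / N k < 1) F"
    using order_tendstoD(2)[OF u0, of 1] filterlim_at_top[THEN iffD1, OF N, rule_format, of 1]
    by (simp add: eventually_conj_iff Suc_le_eq)
  have "((\<lambda>k. real (N k) * ln (1 + u k / N k)) \<longlongrightarrow> u0) F"
  proof (rule tendsto_sandwich)
    show "((\<lambda>k. u k - u k * (u k / N k)) \<longlongrightarrow> u0) F"
      using tendsto_diff[OF u tendsto_mult[OF u u0]] by simp
    show "eventually (\<lambda>k. u k - u k * (u k / N k) \<le> N k * ln (1 + u k / N k)) F"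
      using ev
    proof eventually_elim
      case (elim k)
      have "N k * (u k / N k - (u k / N k)\<^sup>2) \<le> N k * ln (1 + u k / N k)"
        using elim pos[of k] by (intro mult_left_mono ln_one_plus_pos_lower_bound) auto
      then show ?case using elim by (simp add: power2_eq_square right_diff_distrib)
    qed
    show "eventually (\<lambda>k. N k * ln (1 + u k / N k) \<le> u k) F"
      using ev
    proof eventually_elim
      case (elim k)
      have "N k * ln (1 + u k / N k) \<le> N k * (u k / N k)"
        using elim pos[of k] by (intro mult_left_mono ln_add_one_self_le_self) auto
      then show ?case using elim by simp
    qed
  qed (rule u)
  then have "((\<lambda>k. exp (real (N k) * ln (1 + u k / N k))) \<longlongrightarrow> exp u0) F"
    by (rule tendsto_exp)
  also have "(\<lambda>k. exp (real (N k) * ln (1 + u k / N k))) = (\<lambda>k. (1 + u k / N k) ^ N k)"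
  proof
    fix k
    have "1 + u k / N k > 0" using pos[of k] by (simp add: add_pos_nonneg)
    then show "exp (real (N k) * ln (1 + u k / N k)) = (1 + u k / N k) ^ N k"
      by (simp add: exp_of_nat_mult)
  qed
  finally show ?thesis .
qed

lemma tendsto_inverse_one_plus_divide_power:
  fixes u :: "'a \<Rightarrow> real" and N :: "'a \<Rightarrow> nat"
  assumes u: "(u \<longlongrightarrow> u0) F" and N: "filterlim N at_top F" and pos: "\<And>k. u k \<ge> 0"
  shows "((\<lambda>k. 1 / (1 + u k / N k) ^ (m + N k + 1)) \<longlongrightarrow> exp (- u0)) F"
proof -
  have "((\<lambda>k. u k / N k) \<longlongrightarrow> 0) F"
    by (rule real_tendsto_divide_at_top[OF u filterlim_compose[OF filterlim_real_sequentially N]])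
  then have "((\<lambda>k. (1 + u k / N k) ^ (m + 1) * (1 + u k / N k) ^ N k) \<longlongrightarrow> (1 + 0) ^ (m + 1) * exp u0) F"
    by (intro tendsto_intros tendsto_one_plus_divide_power u N pos)
  then have "((\<lambda>k. 1 / ((1 + u k / N k) ^ (m + 1) * (1 + u k / N k) ^ N k)) \<longlongrightarrow> 1 / ((1 + 0) ^ (m + 1) * exp u0)) F"
    by (rule tendsto_divide[OF tendsto_const]) auto
  then show ?thesis
    by (simp add: exp_minus divide_inverse power_add mult_ac)
qed

text \<open>Bernoulli's inequality for the power \<open>N div K\<close>, then raised to the power
  \<open>K\<close>. The polynomial lower bound no longer involves \<open>N\<close>, so its
  reciprocal can dominate.\<close>

lemma one_plus_divide_power_mono:
  fixes u :: real
  assumes K: "K > 0" and N: "K \<le> N" and u: "u \<ge> 0"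
  shows "(1 + u / (2 * K)) ^ K \<le> (1 + u / N) ^ N"
proof -
  define q where "q = N div K"
  have "q \<ge> 1" using K N by (simp add: q_def div_greater_zero_iff Suc_leI)
  have "N = q * K + N mod K" by (simp add: q_def)
  moreover have "N mod K < K" using K by simp
  ultimately have "N < (q + 1) * K" "q * K \<le> N" by (auto simp: algebra_simps)
  \<comment> \<open>Rounding in the integer division is the origin of the 2 in
    \<open>u / (2 * K)\<close>: \<open>q >= 1\<close> gives \<open>q + 1 <= 2 * q\<close>.\<close>
  moreover have "(q + 1) * K \<le> 2 * q * K"
    using \<open>q \<ge> 1\<close> by (intro mult_right_mono) auto
  ultimately have "N \<le> 2 * q * K" by linarith
  then have "real N \<le> real (2 * q * K)" by (simp only: of_nat_le_iff)
  then have "real N \<le> 2 * real q * real K" by simp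
  then have "1 / (2 * real K) \<le> q / N"
    using K N by (simp add: field_simps)
  from mult_left_mono[OF this u] have "u / (2 * K) \<le> q * (u / N)"
    by (simp add: mult.commute)
  then have "1 + u / (2 * K) \<le> 1 + q * (u / N)" by simp
  also have "\<dots> \<le> (1 + u / N) ^ q"
    using u Bernoulli_inequality[of "u / N" q] by (simp add: order_trans[of "-1" 0])
  finally have "(1 + u / (2 * K)) ^ K \<le> ((1 + u / N) ^ q) ^ K"
    using u by (intro power_mono) auto
  also have "\<dots> = (1 + u / N) ^ (q * K)"
    by (simp add: power_mult)
  also have "\<dots> \<le> (1 + u / N) ^ N"
    using u \<open>q * K \<le> N\<close> by (intro power_increasing) auto
  finally show ?thesis by simp
qed

text \<open>In the variable \<open>r = |z|^2\<close> area is \<open>pi\<close> times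
  \<open>dr\<close>, so decay of order \<open>r^(m - K)\<close> with \<open>K - m >= 2\<close>
  suffices; the comparison is with a rescaled \<open>1 / (1 + t^2)\<close>.\<close>

lemma integrable_power_divide_one_plus_power:
  fixes L :: real
  assumes L: "L > 0" and K: "K \<ge> m + 2"
  shows "integrable lborel (\<lambda>z::complex. ((norm z)\<^sup>2) ^ m / (1 + (norm z)\<^sup>2 / L) ^ K)"
proof -
  let ?f = "\<lambda>r. r ^ m / (1 + r / L) ^ K"
  have "integrable lborel (\<lambda>r. indicator {0<..} r *\<^sub>R ?f r)"
  proof (rule Bochner_Integration.integrable_bound)
    have "integrable lborel (\<lambda>t::real. inverse (1 + t\<^sup>2))"
      using integrable_inverse_1_plus_square by (simp add: set_integrable_def)
    then show "integrable lborel (\<lambda>t::real. L ^ m * inverse (1 + (0 + 1 / L * t)\<^sup>2))"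
      using L by (intro integrable_mult_right lborel_integrable_real_affine) auto
    show "AE r in lborel. norm (indicator {0<..} r *\<^sub>R ?f r) \<le> norm (L ^ m * inverse (1 + (0 + 1 / L * r)\<^sup>2))"
    proof (rule AE_I2)
      fix r :: real
      show "norm (indicator {0<..} r *\<^sub>R ?f r) \<le> norm (L ^ m * inverse (1 + (0 + 1 / L * r)\<^sup>2))"
      proof (cases "r > 0")
        case True
        define v where "v = r / L"
        have v: "v > 0" and r: "r = L * v" using True L by (auto simp: v_def)
        have "?f r = L ^ m * (v ^ m / (1 + v) ^ K)"
          using L by (simp add: r power_mult_distrib)
        also have "\<dots> \<le> L ^ m * (1 / (1 + v\<^sup>2))"
        proof (intro mult_left_mono)
          have "v ^ m * (1 + v\<^sup>2) \<le> (1 + v) ^ m * (1 + v) ^ 2"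
            using v by (intro mult_mono power_mono) (auto simp: power2_eq_square algebra_simps)
          also have "\<dots> = (1 + v) ^ (m + 2)" by (simp only: power_add)
          also have "\<dots> \<le> (1 + v) ^ K"
            using v K by (intro power_increasing) auto
          finally show "v ^ m / (1 + v) ^ K \<le> 1 / (1 + v\<^sup>2)"
            using v by (simp add: divide_simps add_pos_pos)
        qed (use L in auto)
        finally have "?f r \<le> L ^ m * (1 / (1 + v\<^sup>2))" .
        moreover have "?f r \<ge> 0" "0 + 1 / L * r = v" "L ^ m * inverse (1 + v\<^sup>2) \<ge> 0"
          using True L by (auto simp: v_def)
        ultimately show ?thesis
          using True L v by (simp add: inverse_eq_divide)
      qed auto
    qed
  qed measurable
  then have "has_bochner_integral lborel (\<lambda>r. indicator {0<..} r *\<^sub>R ?f r)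
      (LINT r|lborel. indicator {0<..} r *\<^sub>R ?f r)"
    by (simp add: has_bochner_integral_iff)
  then show ?thesis
    using has_bochner_integral_cmod_squared[of ?f] by (simp add: has_bochner_integral_iff)
qed

text \<open>Everything rests on a majorant valid for all large \<open>k\<close>. At infinity
  \<open>one_plus_divide_power_mono\<close> supplies the decay; near a vanishing coordinate the
  exponent of \<open>u\<close> must remain nonnegative after division by \<open>u\<close>, and this
  is where \<open>nondeg\<close> enters.\<close>

lemma radial_conv_tendsto:
  fixes \<nu> \<phi> :: "nat \<Rightarrow> nat" and x :: "nat \<Rightarrow> real"
  assumes \<phi>: "filterlim \<phi> at_top sequentially" and x: "x \<longlonglongrightarrow> x0" and x_nonneg: "\<And>k. x k \<ge> 0"
    and \<nu>1: "\<nu> 1 = 0" and nondeg: "(\<forall>j\<in>{2..n}. \<nu> j > 0) \<or> x0 > 0"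
  shows "(\<lambda>k. radial_conv (\<lambda>j u. u ^ \<nu> j / (1 + u / \<phi> k) ^ (\<nu> j + \<phi> k + 1)) n (x k))
    \<longlonglongrightarrow> radial_conv (\<lambda>j u. u ^ \<nu> j * exp (- u)) n x0"
proof -
  let ?P = "PiM {2..n} (\<lambda>_. lborel :: complex measure)"
  define p where "p y = (\<Prod>j=2..n. (norm (y j))\<^sup>2)" for y :: "nat \<Rightarrow> complex"
  have p_nonneg: "p y \<ge> 0" for y unfolding p_def by (intro prod_nonneg) auto
  define e where "e N j u = u ^ \<nu> j / (1 + u / real N) ^ (\<nu> j + N + 1)" for N j u
  define f where "f j u = u ^ \<nu> j * exp (- u)" for j and u :: real
  have e_nonneg: "e N j u \<ge> 0" if "u \<ge> 0" for N j u
    using that by (auto simp: e_def)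
  have e1: "e N 1 u = 1 / (1 + u / N) ^ (N + 1)" for N u
    using \<nu>1 by (simp add: e_def)
  define g where "g h r y = h (1::nat) (r / p y) * (\<Prod>j=2..n. h j ((norm (y j))\<^sup>2) / (norm (y j))\<^sup>2)"
    for h :: "nat \<Rightarrow> real \<Rightarrow> real" and r y
  have radial: "radial_conv h n r = (LINT y|?P. g h r y)" for h r
    by (simp add: radial_conv_def g_def p_def)
  have meas: "g h r \<in> borel_measurable ?P" if "\<And>j. h j \<in> borel_measurable borel" for h r
    unfolding g_def[abs_def] p_def using measurable_radial_conv_integrand[of h r n] that by simp
  have meas_e: "g (e N) r \<in> borel_measurable ?P" for N r
    by (rule meas) (unfold e_def, measurable)
  have meas_f: "g f r \<in> borel_measurable ?P" for r
    by (rule meas) (unfold f_def, measurable)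
  \<comment> \<open>Division by 0 makes the factor of a vanishing coordinate 0, so bounds and limits
    hold at every point and not just almost everywhere.\<close>
  have prod_zero: "(\<Prod>j=2..n. h j ((norm (y j))\<^sup>2) / (norm (y j))\<^sup>2) = 0" if "p y = 0"
    for h :: "nat \<Rightarrow> real \<Rightarrow> real" and y :: "nat \<Rightarrow> complex"
    using that by (force simp: p_def)
  \<comment> \<open>The sum is at least each \<open>\<nu> j\<close>, so one exponent serves all
    variables; the added 3 covers the margin of 2 in
    \<open>integrable_power_divide_one_plus_power\<close>, also when \<open>a = 1\<close>.\<close>
  define K where "K = (\<Sum>j=1..n. \<nu> j) + 3"
  have K: "\<nu> j + 3 \<le> K" if "j \<in> {2..n}" for j
    using that member_le_sum[of j "{1..n}" \<nu>] by (auto simp: K_def)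
  have K_pos: "K > 0" by (simp add: K_def)
  \<comment> \<open>Near \<open>x0 > 0\<close> the first factor supplies a power \<open>a = 1\<close> of the product of all \<open>(norm (y j))\<^sup>2\<close>,
    which restores integrability at \<open>y j = 0\<close> for the indices with \<open>\<nu> j = 0\<close>.\<close>
  obtain a C where C: "C \<ge> 0" and a: "a \<le> 1" "\<And>j. j \<in> {2..n} \<Longrightarrow> a + \<nu> j \<ge> 1"
    and C_bound: "eventually (\<lambda>k. \<forall>q>0. e (\<phi> k) 1 (x k / q) \<le> C * q ^ a) sequentially"
  proof -
    consider "\<forall>j\<in>{2..n}. \<nu> j > 0" | "x0 > 0" using nondeg by blast
    then show ?thesis
    proof cases
      case 1
      \<comment> \<open>The first factor is at most 1, and positive \<open>\<nu> j\<close> already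
        cancel the division, so \<open>a = 0\<close> works.\<close>
      have "e (\<phi> k) 1 (x k / q) \<le> 1 * q ^ 0" if "q > 0" for k q
      proof -
        have "1 \<le> (1 + x k / q / \<phi> k) ^ (\<phi> k + 1)"
          using x_nonneg[of k] that by (intro one_le_power) simp
        then have "1 / (1 + x k / q / \<phi> k) ^ (\<phi> k + 1) \<le> 1"
          by (simp only: divide_le_eq_1) auto
        then show ?thesis by (simp only: e1 power_0 mult_1)
      qed
      then show ?thesis
        using 1 by (intro that[of 1 0]) (auto simp: Suc_le_eq)
    next
      case 2
      have "eventually (\<lambda>k. x k > x0 / 2 \<and> \<phi> k \<ge> 1) sequentially"
        using order_tendstoD(1)[OF x, of "x0 / 2"] 2 filterlim_at_top[THEN iffD1, OF \<phi>, rule_format, of 1]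
        by (simp add: eventually_conj_iff)
      then have "eventually (\<lambda>k. \<forall>q>0. e (\<phi> k) 1 (x k / q) \<le> 2 / x0 * q ^ 1) sequentially"
      proof eventually_elim
        case (elim k)
        show ?case
        proof (intro allI impI)
          fix q :: real assume q: "q > 0"
          define u where "u = x k / q"
          have u: "u > 0" using elim 2 q by (simp add: u_def)
          \<comment> \<open>Bernoulli bounds the first factor by \<open>1 / u = q / x k\<close>,
            which is linear in \<open>q\<close>; \<open>x k > x0 / 2\<close> makes the constant
            uniform in \<open>k\<close>.\<close>
          have "u \<le> 1 + \<phi> k * (u / \<phi> k)"
            using elim by simp
          also have "\<dots> \<le> (1 + u / \<phi> k) ^ \<phi> k"
            using u Bernoulli_inequality[of "u / \<phi> k" "\<phi> k"] by (simp add: order_trans[of "-1" 0])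
          also have "\<dots> \<le> (1 + u / \<phi> k) ^ (\<phi> k + 1)"
            using u by (intro power_increasing) auto
          finally have "e (\<phi> k) 1 u \<le> 1 / u"
            unfolding e1 using u by (intro divide_left_mono mult_pos_pos zero_less_power) (auto intro: add_pos_nonneg)
          also have "\<dots> = q / x k" by (simp add: u_def)
          also have "\<dots> \<le> q / (x0 / 2)"
            using elim 2 q by (intro divide_left_mono) auto
          finally show "e (\<phi> k) 1 (x k / q) \<le> 2 / x0 * q ^ 1"
            by (simp add: u_def mult.commute)
        qed
      qed
      then show ?thesis
        using 2 by (intro that[of "2 / x0" 1]) auto
    qed
  qed
  define w where "w y = C * (\<Prod>j=2..n. ((norm (y j))\<^sup>2) ^ (a + \<nu> j - 1) / (1 + (norm (y j))\<^sup>2 / (2 * real K)) ^ K)"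
    for y :: "nat \<Rightarrow> complex"
  have w_int: "integrable ?P w"
  proof -
    interpret product_sigma_finite "\<lambda>_::nat. lborel :: complex measure" ..
    show ?thesis
      unfolding w_def
    proof (intro integrable_mult_right product_integrable_prod[where
          f = "\<lambda>j z. ((norm z)\<^sup>2) ^ (a + \<nu> j - 1) / (1 + (norm z)\<^sup>2 / (2 * real K)) ^ K"]
          integrable_power_divide_one_plus_power)
      show "a + \<nu> j - 1 + 2 \<le> K" if "j \<in> {2..n}" for j
        using K[OF that] a(1) by simp
    qed (use K_pos in auto)
  qed
  have "eventually (\<lambda>k. \<phi> k \<ge> K) sequentially"
    using filterlim_at_top[THEN iffD1, OF \<phi>] by blast
  with C_bound have "eventually (\<lambda>k. \<forall>y. norm (g (e (\<phi> k)) (x k) y) \<le> w y) sequentially"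
  proof eventually_elim
    case (elim k)
    show ?case
    proof
      fix y :: "nat \<Rightarrow> complex"
      have w_nonneg: "w y \<ge> 0"
        unfolding w_def using C by (intro mult_nonneg_nonneg prod_nonneg) auto
      show "norm (g (e (\<phi> k)) (x k) y) \<le> w y"
      proof (cases "p y = 0")
        case True
        then show ?thesis using w_nonneg by (simp add: g_def prod_zero)
      next
        case False
        then have pos: "norm (y j) > 0" if "j \<in> {2..n}" for j
          using that by (auto simp: p_def)
        have p_pos: "p y > 0" using False p_nonneg[of y] by simp
        have fac: "u ^ a * (e (\<phi> k) j u / u) \<le> u ^ (a + \<nu> j - 1) / (1 + u / (2 * real K)) ^ K"
          if "j \<in> {2..n}" "u > 0" for j u
        proof -
          have "(1 + u / (2 * real K)) ^ K \<le> (1 + u / \<phi> k) ^ \<phi> k"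
            using one_plus_divide_power_mono[OF K_pos elim(2), of u] that by simp
          also have "\<dots> \<le> (1 + u / \<phi> k) ^ (\<nu> j + \<phi> k + 1)"
            using that by (intro power_increasing) auto
          finally have le: "(1 + u / (2 * real K)) ^ K \<le> (1 + u / \<phi> k) ^ (\<nu> j + \<phi> k + 1)" .
          have "u ^ a * (e (\<phi> k) j u / u) = u ^ (a + \<nu> j - 1) / (1 + u / \<phi> k) ^ (\<nu> j + \<phi> k + 1)"
          proof -
            have "u ^ (a + \<nu> j) = u ^ (a + \<nu> j - 1) * u"
              using a(2)[OF that(1)] by (metis Suc_diff_1 less_eq_Suc_le power_Suc2 One_nat_def)
            then show ?thesis
              using that by (simp add: e_def power_add)
          qed
          also have "\<dots> \<le> u ^ (a + \<nu> j - 1) / (1 + u / (2 * real K)) ^ K"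
            using le that K_pos by (intro divide_left_mono mult_pos_pos zero_less_power) (auto intro!: add_pos_nonneg)
          finally show ?thesis .
        qed
        have "norm (g (e (\<phi> k)) (x k) y) =
            e (\<phi> k) 1 (x k / p y) * (\<Prod>j=2..n. e (\<phi> k) j ((norm (y j))\<^sup>2) / (norm (y j))\<^sup>2)"
          unfolding g_def using x_nonneg[of k] p_pos e_nonneg
          by (simp add: abs_mult abs_prod)
        also have "\<dots> \<le> (C * p y ^ a) * (\<Prod>j=2..n. e (\<phi> k) j ((norm (y j))\<^sup>2) / (norm (y j))\<^sup>2)"
          using elim(1) p_pos by (intro mult_right_mono prod_nonneg) (auto intro!: divide_nonneg_nonneg e_nonneg)
        \<comment> \<open>Distributing \<open>p y ^ a\<close> over the variables hands each one the
          factor \<open>u ^ a\<close> that \<open>fac\<close> expects.\<close>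
        also have "\<dots> = C * (\<Prod>j=2..n. ((norm (y j))\<^sup>2) ^ a * (e (\<phi> k) j ((norm (y j))\<^sup>2) / (norm (y j))\<^sup>2))"
          by (simp only: prod.distrib p_def prod_power_distrib mult.assoc)
        also have "\<dots> \<le> w y"
          unfolding w_def using C pos
          by (intro mult_left_mono prod_mono conjI fac)
            (auto intro!: mult_nonneg_nonneg divide_nonneg_nonneg e_nonneg)
        finally show ?thesis .
      qed
    qed
  qed
  then obtain k0 where k0: "\<And>k y. k \<ge> k0 \<Longrightarrow> norm (g (e (\<phi> k)) (x k) y) \<le> w y"
    unfolding eventually_sequentially by blast
  have lim: "(\<lambda>k. g (e (\<phi> k)) (x k) y) \<longlonglongrightarrow> g f x0 y" for y
  proof (cases "p y = 0")
    case True
    then show ?thesis by (simp add: g_def prod_zero)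
  next
    case False
    then have p_pos: "p y > 0" using p_nonneg[of y] by simp
    have 1: "(\<lambda>k. e (\<phi> k) 1 (x k / p y)) \<longlonglongrightarrow> f 1 (x0 / p y)"
    proof -
      have "(\<lambda>k. 1 / (1 + x k / p y / \<phi> k) ^ (0 + \<phi> k + 1)) \<longlonglongrightarrow> exp (- (x0 / p y))"
        using x_nonneg p_pos by (intro tendsto_inverse_one_plus_divide_power \<phi> tendsto_divide x) auto
      then show ?thesis by (simp only: e1 f_def \<nu>1 add_0 power_0 mult_1)
    qed
    have 2: "(\<lambda>k. e (\<phi> k) j u) \<longlonglongrightarrow> f j u" if "u \<ge> 0" for j u
    proof -
      have "(\<lambda>k. u ^ \<nu> j * (1 / (1 + u / \<phi> k) ^ (\<nu> j + \<phi> k + 1))) \<longlonglongrightarrow> u ^ \<nu> j * exp (- u)"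
        using that by (intro tendsto_mult tendsto_const tendsto_inverse_one_plus_divide_power \<phi>)
      then show ?thesis by (simp add: e_def f_def)
    qed
    show ?thesis
      unfolding g_def using False
      by (intro tendsto_mult 1 tendsto_prod tendsto_divide 2 tendsto_const) (auto simp: p_def)
  qed
  \<comment> \<open>The majorant is valid from \<open>k0\<close> on, hence the shift of the
    sequence.\<close>
  have "(\<lambda>k. LINT y|?P. g (e (\<phi> (k + k0))) (x (k + k0)) y) \<longlonglongrightarrow> (LINT y|?P. g f x0 y)"
  proof (rule integral_dominated_convergence[where w = w])
    show "AE y in ?P. (\<lambda>k. g (e (\<phi> (k + k0))) (x (k + k0)) y) \<longlonglongrightarrow> g f x0 y"
      by (intro AE_I2 LIMSEQ_ignore_initial_segment lim)
    show "AE y in ?P. norm (g (e (\<phi> (k + k0))) (x (k + k0)) y) \<le> w y" for k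
      by (intro AE_I2 k0) simp
  qed (use w_int meas_e meas_f in auto)
  then have "(\<lambda>k. LINT y|?P. g (e (\<phi> k)) (x k) y) \<longlonglongrightarrow> (LINT y|?P. g f x0 y)"
    by (rule LIMSEQ_offset)
  then show ?thesis
    by (simp add: radial e_def[abs_def] f_def[abs_def])
qed

lemma radial_conv_exp_nonneg:
  "x \<ge> 0 \<Longrightarrow> radial_conv (\<lambda>j u. u ^ \<nu> j * exp (- u)) n x \<ge> 0"
  unfolding radial_conv_def
  by (intro Bochner_Integration.integral_nonneg mult_nonneg_nonneg prod_nonneg) (auto intro!: divide_nonneg_nonneg zero_le_power prod_nonneg)

section \<open>Coefficients of the kernel and convergence of its sum\<close>

text \<open>The Gamma quotient of one index, normalised to tend to 1. In the exponent of
  \<open>N\<close>, \<open>m\<close> matches the \<open>N ^ \<nu> j\<close> split off the weight,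
  \<open>k\<close> the scale inside \<open>(z * cnj w) ^ k\<close>, and 1 the Jacobian
  \<open>N ^ n\<close>.\<close>

definition kernel_coeff :: "nat \<Rightarrow> nat \<Rightarrow> nat \<Rightarrow> real" where
  "kernel_coeff m N k = Gamma (real m + real N + 1) / (Gamma (real N - real k) * real N ^ (m + k + 1))"

text \<open>The quotient is a rising factorial starting at \<open>N - k\<close>, with as many
  factors as there are powers of \<open>N\<close> in the denominator.\<close>

lemma kernel_coeff_eq_prod:
  assumes "k < N"
  shows "kernel_coeff m N k = (\<Prod>l<m + k + 1. (real N - real k + real l) / real N)"
proof -
  have "real N - real k > 0" using assms by simp
  then have "pochhammer (real N - real k) (m + k + 1) = Gamma (real m + real N + 1) / Gamma (real N - real k)"
    by (subst pochhammer_Gamma) (auto elim!: nonpos_Ints_cases simp: algebra_simps)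
  then show ?thesis
    by (simp add: kernel_coeff_def pochhammer_prod prod_dividef atLeast0LessThan)
qed

text \<open>Each factor is at most \<open>(N + m) / N <= 1 + m\<close>, since
  \<open>l <= m + k\<close>. The bound is geometric in \<open>k\<close> and free of
  \<open>N\<close>, as Tannery's theorem demands.\<close>

lemma kernel_coeff_bounds:
  assumes "k < N"
  shows "0 \<le> kernel_coeff m N k" "kernel_coeff m N k \<le> (1 + real m) ^ (m + k + 1)"
proof -
  have nn: "0 \<le> (real N - real k + real l) / real N" for l using assms by simp
  show "0 \<le> kernel_coeff m N k"
    unfolding kernel_coeff_eq_prod[OF assms] by (intro prod_nonneg) (use nn in auto)
  have "(real N - real k + real l) / real N \<le> 1 + real m" if "l < m + k + 1" for l
  proof -
    have "real N - real k + real l \<le> real N + real m" using that by simp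
    also have "\<dots> \<le> real N + real m * real N" using assms by (simp add: mult_le_cancel_left1)
    finally show ?thesis using assms by (simp add: field_simps)
  qed
  then have "kernel_coeff m N k \<le> (\<Prod>l<m + k + 1. 1 + real m)"
    unfolding kernel_coeff_eq_prod[OF assms] by (intro prod_mono) (use nn in auto)
  then show "kernel_coeff m N k \<le> (1 + real m) ^ (m + k + 1)" by simp
qed

lemma kernel_coeff_tendsto:
  assumes "filterlim \<phi> at_top F"
  shows "((\<lambda>i. kernel_coeff m (\<phi> i) k) \<longlongrightarrow> 1) F"
proof -
  have *: "filterlim (\<lambda>i. real (\<phi> i)) at_top F"
    by (rule filterlim_compose[OF filterlim_real_sequentially assms])
  have "((\<lambda>i. \<Prod>l<m + k + 1. 1 + (real l - real k) / real (\<phi> i)) \<longlongrightarrow> (\<Prod>l<m + k + 1. 1 + 0)) F"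
    by (intro tendsto_prod tendsto_add tendsto_const real_tendsto_divide_at_top[OF tendsto_const *])
  moreover have "eventually (\<lambda>i. (\<Prod>l<m + k + 1. 1 + (real l - real k) / real (\<phi> i)) = kernel_coeff m (\<phi> i) k) F"
    using filterlim_at_top[THEN iffD1, OF assms, rule_format, of "Suc k"]
    by eventually_elim (auto simp: kernel_coeff_eq_prod field_simps intro!: prod.cong)
  ultimately show ?thesis
    by (simp add: tendsto_cong)
qed

lemma kernel_sum_tendsto:
  fixes \<nu> \<phi> :: "nat \<Rightarrow> nat" and \<zeta> :: "nat \<Rightarrow> complex"
  assumes \<phi>: "filterlim \<phi> at_top sequentially" and \<zeta>: "\<zeta> \<longlonglongrightarrow> \<zeta>0" and n: "n \<ge> 1" and \<nu>1: "\<nu> 1 = 0"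
  shows "(\<lambda>i. \<Sum>k<\<phi> i. of_real (\<Prod>j=1..n. kernel_coeff (\<nu> j) (\<phi> i) k / Gamma (real (\<nu> j) + real k + 1)) * \<zeta> i ^ k)
    \<longlonglongrightarrow> (\<Sum>k. of_real (\<Prod>j=1..n. 1 / Gamma (real (\<nu> j) + real k + 1)) * \<zeta>0 ^ k)"
proof -
  \<comment> \<open>Extension by 0 beyond \<open>\<phi> i\<close> turns sums of growing length into
    series over a common index range.\<close>
  define t where "t k i = (if k < \<phi> i then of_real (\<Prod>j=1..n. kernel_coeff (\<nu> j) (\<phi> i) k /
     Gamma (real (\<nu> j) + real k + 1)) * \<zeta> i ^ k else 0)" for k i
  obtain Z where Z: "Z > 0" "\<And>i. norm (\<zeta> i) \<le> Z"
    using convergent_imp_Bseq[OF convergentI[OF \<zeta>]] by (auto simp: Bseq_def)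
  \<comment> \<open>\<open>(1 + \<nu> j) ^ (\<nu> j + k + 1)\<close> is separated into a part
    constant in \<open>k\<close>, collected in \<open>D\<close>, and a geometric part, collected in
    \<open>B ^ k\<close>.\<close>
  define D B where "D = (\<Prod>j=1..n. (1 + real (\<nu> j)) ^ (\<nu> j + 1))" and "B = (\<Prod>j=1..n. 1 + real (\<nu> j))"
  have D: "D \<ge> 0" and B: "B \<ge> 0" by (auto simp: D_def B_def intro!: prod_nonneg)
  have Gamma_fact: "Gamma (real m + real k + 1) = fact (m + k)" for m k
    using Gamma_fact[of "m + k", where 'a = real] by (simp add: add_ac)
  have bound: "norm (t k i) \<le> D * ((B * Z) ^ k / fact k)" for k i
  proof (cases "k < \<phi> i")
    case True
    have "(\<Prod>j=1..n. kernel_coeff (\<nu> j) (\<phi> i) k / Gamma (real (\<nu> j) + real k + 1)) =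
       (\<Prod>j=1..n. kernel_coeff (\<nu> j) (\<phi> i) k) / (\<Prod>j=1..n. fact (\<nu> j + k))"
      by (simp add: Gamma_fact prod_dividef)
    also have "\<dots> \<le> (D * B ^ k) / fact k"
    proof (intro frac_le)
      have "(\<Prod>j=1..n. kernel_coeff (\<nu> j) (\<phi> i) k) \<le> (\<Prod>j=1..n. (1 + real (\<nu> j)) ^ (\<nu> j + k + 1))"
        by (intro prod_mono conjI kernel_coeff_bounds True)
      also have "\<dots> = D * B ^ k"
        unfolding D_def B_def prod_power_distrib prod.distrib[symmetric]
        by (intro prod.cong refl) (simp add: power_add)
      finally show "(\<Prod>j=1..n. kernel_coeff (\<nu> j) (\<phi> i) k) \<le> D * B ^ k" .
      have eq: "{1..n} = insert 1 {2..n}" using n by auto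
      \<comment> \<open>One factorial is enough for summability: \<open>j = 1\<close> gives
        \<open>fact k\<close> because \<open>\<nu> 1 = 0\<close>, and the others are at least
        1.\<close>
      have "1 \<le> (\<Prod>j=2..n. fact (\<nu> j + k) :: real)"
        by (intro prod_ge_1) auto
      then show "fact k \<le> (\<Prod>j=1..n. fact (\<nu> j + k) :: real)"
        unfolding eq using \<nu>1 by (simp add: mult_le_cancel_left1)
    qed (use D B in auto)
    finally have "(\<Prod>j=1..n. kernel_coeff (\<nu> j) (\<phi> i) k / Gamma (real (\<nu> j) + real k + 1)) \<le> (D * B ^ k) / fact k" .
    moreover have "0 \<le> (\<Prod>j=1..n. kernel_coeff (\<nu> j) (\<phi> i) k / Gamma (real (\<nu> j) + real k + 1))"
      by (intro prod_nonneg ballI divide_nonneg_nonneg kernel_coeff_bounds True) (simp add: Gamma_fact)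
    moreover have "norm (\<zeta> i) ^ k \<le> Z ^ k" by (intro power_mono Z(2)) auto
    ultimately have "\<bar>\<Prod>j=1..n. kernel_coeff (\<nu> j) (\<phi> i) k / Gamma (real (\<nu> j) + real k + 1)\<bar> * norm (\<zeta> i) ^ k
        \<le> (D * B ^ k) / fact k * Z ^ k"
      using D B by (intro mult_mono) auto
    then have "norm (t k i) \<le> (D * B ^ k) / fact k * Z ^ k"
      unfolding t_def using True by (simp only: norm_mult norm_power norm_of_real if_True)
    then show ?thesis by (simp add: power_mult_distrib)
  qed (use D B Z in \<open>simp add: t_def\<close>)
  have lim: "(\<lambda>i. t k i) \<longlonglongrightarrow> of_real (\<Prod>j=1..n. 1 / Gamma (real (\<nu> j) + real k + 1)) * \<zeta>0 ^ k" for k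
  proof -
    have "(\<lambda>i. of_real (\<Prod>j=1..n. kernel_coeff (\<nu> j) (\<phi> i) k / Gamma (real (\<nu> j) + real k + 1)) * \<zeta> i ^ k)
       \<longlonglongrightarrow> of_real (\<Prod>j=1..n. 1 / Gamma (real (\<nu> j) + real k + 1)) * \<zeta>0 ^ k"
      by (intro tendsto_mult tendsto_of_real tendsto_prod tendsto_divide tendsto_power \<zeta>
          kernel_coeff_tendsto \<phi> tendsto_const) (simp add: Gamma_fact)
    moreover have "eventually (\<lambda>i. of_real (\<Prod>j=1..n. kernel_coeff (\<nu> j) (\<phi> i) k /
        Gamma (real (\<nu> j) + real k + 1)) * \<zeta> i ^ k = t k i) sequentially"
      using filterlim_at_top[THEN iffD1, OF \<phi>, rule_format, of "Suc k"]
      by eventually_elim (simp add: t_def)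
    ultimately show ?thesis by (rule Lim_transform_eventually)
  qed
  have "summable (\<lambda>k. D * ((B * Z) ^ k / fact k))"
    using summable_exp[of "B * Z"] by (intro summable_mult) (simp add: field_simps)
  moreover have "eventually (\<lambda>(k, i). norm (t k i) \<le> D * ((B * Z) ^ k / fact k)) (at_top \<times>\<^sub>F sequentially)"
    using bound by (intro always_eventually) auto
  ultimately have "(\<lambda>i. \<Sum>k. t k i) \<longlonglongrightarrow> (\<Sum>k. of_real (\<Prod>j=1..n. 1 / Gamma (real (\<nu> j) + real k + 1)) * \<zeta>0 ^ k)"
    using tannerys_theorem[of t, OF lim _ _ sequentially_bot] by simp
  also have "(\<lambda>i. \<Sum>k. t k i) = (\<lambda>i. \<Sum>k<\<phi> i. of_real (\<Prod>j=1..n. kernel_coeff (\<nu> j) (\<phi> i) k / Gamma (real (\<nu> j) + real k + 1)) * \<zeta> i ^ k)"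
    by (intro ext, subst suminf_finite[of "{..<\<phi> _}"]) (auto simp: t_def)
  finally show ?thesis .
qed

section \<open>The rescaled weight and kernel at finite N\<close>

lemma radial_conv_cmult:
  assumes "n \<ge> 1"
  shows "radial_conv (\<lambda>j u. c j * e j u) n x = (\<Prod>j=1..n. c j) * radial_conv e n x"
proof -
  have "{1..n} = insert 1 {2..n}" using assms by auto
  then have eq: "(\<Prod>j=1..n. c j) = c 1 * (\<Prod>j=2..n. c j)" by simp
  show ?thesis
    unfolding radial_conv_def eq
    by (subst integral_mult_right_zero[symmetric], intro Bochner_Integration.integral_cong refl)
      (simp add: prod.distrib mult_ac flip: times_divide_eq_right)
qed

lemma product_weight_scaled:
  fixes \<zeta> :: complex
  assumes n: "n \<ge> 1" and N: "N \<ge> 1"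
  shows "product_weight \<nu> n N (\<zeta> / of_real (real N powr (real n / 2))) =
    radial_conv (\<lambda>j u. u ^ \<nu> j / (1 + u / N) ^ (\<nu> j + N + 1)) n ((norm \<zeta>)\<^sup>2) / (\<Prod>j=1..n. real N ^ \<nu> j)"
proof -
  have "(real N powr (real n / 2))\<^sup>2 = real N ^ n"
    using N by (simp add: powr_powr flip: powr_numeral powr_realpow)
  then have "(norm (\<zeta> / of_real (real N powr (real n / 2))))\<^sup>2 = (norm \<zeta>)\<^sup>2 / real N ^ n"
    by (simp add: norm_divide power_divide)
  then have "product_weight \<nu> n N (\<zeta> / of_real (real N powr (real n / 2))) =
      radial_conv (\<lambda>j u. u ^ \<nu> j / (1 + u) ^ (\<nu> j + N + 1)) n ((norm \<zeta>)\<^sup>2 / real N ^ n)"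
    by (simp only: product_weight_eq_radial_conv)
  also have "\<dots> = radial_conv (\<lambda>j u. (u / N) ^ \<nu> j / (1 + u / N) ^ (\<nu> j + N + 1)) n ((norm \<zeta>)\<^sup>2)"
    using N n by (intro radial_conv_scale) auto
  also have "\<dots> = radial_conv (\<lambda>j u. 1 / real N ^ \<nu> j * (u ^ \<nu> j / (1 + u / N) ^ (\<nu> j + N + 1))) n ((norm \<zeta>)\<^sup>2)"
    by (simp add: power_divide)
  also have "\<dots> = (\<Prod>j=1..n. 1 / real N ^ \<nu> j) *
      radial_conv (\<lambda>j u. u ^ \<nu> j / (1 + u / N) ^ (\<nu> j + N + 1)) n ((norm \<zeta>)\<^sup>2)"
    by (rule radial_conv_cmult[OF n])
  finally show ?thesis
    by (simp add: prod_dividef)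
qed

lemma scaled_product_kernel_eq:
  fixes \<nu> :: "nat \<Rightarrow> nat" and \<xi> \<eta> :: complex
  assumes n: "n \<ge> 1" and N: "N \<ge> 1"
  defines "W \<equiv> \<lambda>\<zeta>. radial_conv (\<lambda>j u. u ^ \<nu> j / (1 + u / N) ^ (\<nu> j + N + 1)) n ((norm \<zeta>)\<^sup>2)"
  shows "1 / of_nat N ^ n * product_kernel \<nu> n N (\<xi> / of_real (real N powr (real n / 2)))
      (\<eta> / of_real (real N powr (real n / 2))) =
    of_real (1 / pi ^ n * sqrt (W \<xi> * W \<eta>)) *
    (\<Sum>k<N. of_real (\<Prod>j=1..n. kernel_coeff (\<nu> j) N k / Gamma (real (\<nu> j) + real k + 1)) * (\<xi> * cnj \<eta>) ^ k)"
proof -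
  define s where "s = real N powr (real n / 2)"
  define M where "M = (\<Prod>j=1..n. real N ^ \<nu> j)"
  have M: "M > 0" using N unfolding M_def by (intro prod_pos) auto
  have s: "s\<^sup>2 = real N ^ n"
    using N by (simp add: s_def powr_powr flip: powr_numeral powr_realpow)
  have weight: "product_weight \<nu> n N (\<zeta> / of_real s) = W \<zeta> / M" for \<zeta>
    unfolding s_def M_def W_def by (rule product_weight_scaled[OF n N])
  \<comment> \<open>Each weight carries \<open>1 / M\<close>; the square root of the product keeps
    exactly one of them.\<close>
  have sqrt: "sqrt (W \<xi> / M * (W \<eta> / M)) = sqrt (W \<xi> * W \<eta>) / M"
    using M by (simp add: real_sqrt_divide real_sqrt_mult)
  have pow: "(\<xi> / of_real s * cnj (\<eta> / of_real s)) ^ k = (\<xi> * cnj \<eta>) ^ k / of_real (real N ^ (n * k))" for k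
  proof -
    have "complex_of_real s * complex_of_real s = of_real (real N ^ n)"
      using s by (simp add: power2_eq_square flip: of_real_mult)
    then show ?thesis
      by (simp add: power_mult power_divide)
  qed
  have coeff: "(\<Prod>j=1..n. kernel_coeff (\<nu> j) N k / Gamma (real (\<nu> j) + real k + 1)) =
      1 / real N ^ n * (1 / M) * (1 / real N ^ (n * k)) * (1 / Gamma (real N - real k) ^ n *
        (\<Prod>i=1..n. Gamma (real (\<nu> i) + real N + 1) / Gamma (real (\<nu> i) + real k + 1)))" for k
  proof -
    define Q where "Q j = real N ^ (\<nu> j + k + 1)" for j
    have Q: "(\<Prod>j=1..n. Q j) = M * real N ^ (n * k) * real N ^ n"
      by (simp add: Q_def M_def power_add prod.distrib mult_ac flip: power_mult)
    show ?thesis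
      unfolding kernel_coeff_def Q_def[symmetric] prod_dividef prod.distrib Q by simp
  qed
  have "1 / of_nat N ^ n * product_kernel \<nu> n N (\<xi> / of_real s) (\<eta> / of_real s) =
    (\<Sum>k<N. of_real (1 / pi ^ n * sqrt (W \<xi> * W \<eta>)) *
      (of_real (\<Prod>j=1..n. kernel_coeff (\<nu> j) N k / Gamma (real (\<nu> j) + real k + 1)) * (\<xi> * cnj \<eta>) ^ k))"
    unfolding product_kernel_def weight sqrt sum_distrib_left pow coeff
    by (intro sum.cong refl) (simp add: mult_ac)
  then show ?thesis
    by (simp only: s_def sum_distrib_left)
qed

section \<open>Identification of the limit: hypergeometric series and Meijer function\<close>

lemma pochhammer_one_plus_of_nat:
  "pochhammer (1 + of_nat m :: 'a::field_char_0) k = fact (m + k) / fact m"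
  using pochhammer_product[of m "m + k" "1 :: 'a"] by (simp add: field_simps flip: pochhammer_fact)

text \<open>The index 1 has \<open>\<nu> 1 = 0\<close> and supplies the \<open>fact k\<close> of the
  series; each further index gives a Pochhammer symbol, with its constant
  \<open>fact (\<nu> j)\<close> moved to the prefactor.\<close>

lemma kernel_series_eq_hypergeom:
  fixes x :: complex and n :: nat and \<nu> :: "nat \<Rightarrow> nat"
  assumes n: "n \<ge> 1" and \<nu>1: "\<nu> 1 = 0"
  shows "(\<Sum>k. of_real (\<Prod>j=1..n. 1 / Gamma (real (\<nu> j) + real k + 1)) * x ^ k) =
    hypergeom_0F {2..n} (\<lambda>i. 1 + of_nat (\<nu> i)) x / (\<Prod>i=1..n. Gamma (1 + of_nat (\<nu> i)))"
proof -
  define P where "P k = (\<Prod>j=2..n. pochhammer (1 + of_nat (\<nu> j) :: complex) k)" for k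
  have eq: "{1..n} = insert 1 {2..n}" using n by auto
  have P: "P k = (\<Prod>j=2..n. fact (\<nu> j + k)) / (\<Prod>j=2..n. fact (\<nu> j))" for k
    by (simp add: P_def pochhammer_one_plus_of_nat prod_dividef)
  have "summable (\<lambda>k. 1 / P k * (x ^ k / fact k))"
  proof (rule summable_comparison_test')
    show "summable (\<lambda>k. norm x ^ k / fact k)"
      using summable_exp[of "norm x"] by (simp add: field_simps)
    show "norm (1 / P k * (x ^ k / fact k)) \<le> norm x ^ k / fact k" for k
    proof -
      have "norm (P k) = (\<Prod>j=2..n. fact (\<nu> j + k) / fact (\<nu> j))"
        unfolding P_def pochhammer_one_plus_of_nat by (simp add: prod_norm[symmetric] norm_divide)
      also have "\<dots> \<ge> 1"
        by (intro prod_ge_1) (simp add: fact_mono)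
      finally have "1 / norm (P k) \<le> 1"
        by (simp add: divide_le_eq_1)
      then have "1 / norm (P k) * (norm x ^ k / fact k) \<le> 1 * (norm x ^ k / fact k)"
        by (intro mult_right_mono) auto
      then show ?thesis by (simp add: norm_mult norm_divide norm_power)
    qed
  qed
  then have "hypergeom_0F {2..n} (\<lambda>i. 1 + of_nat (\<nu> i)) x / (\<Prod>i=1..n. Gamma (1 + of_nat (\<nu> i))) =
      (\<Sum>k. 1 / P k * (x ^ k / fact k) / (\<Prod>i=1..n. Gamma (1 + of_nat (\<nu> i))))"
    unfolding hypergeom_0F_def P_def by (rule suminf_divide[symmetric])
  also have "\<dots> = (\<Sum>k. of_real (\<Prod>j=1..n. 1 / Gamma (real (\<nu> j) + real k + 1)) * x ^ k)"
  proof (rule suminf_cong)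
    fix k
    have "Gamma (real m + real k + 1) = fact (m + k)" for m
      using Gamma_fact[of "m + k", where 'a = real] by (simp add: add_ac)
    then have "complex_of_real (\<Prod>j=1..n. 1 / Gamma (real (\<nu> j) + real k + 1)) = 1 / (\<Prod>j=1..n. fact (\<nu> j + k))"
      by (simp add: prod_dividef)
    also have "\<dots> = 1 / (fact k * (\<Prod>j=2..n. fact (\<nu> j + k)))"
      unfolding eq using \<nu>1 by simp
    finally have 1: "complex_of_real (\<Prod>j=1..n. 1 / Gamma (real (\<nu> j) + real k + 1)) =
      1 / (fact k * (\<Prod>j=2..n. fact (\<nu> j + k)))" .
    have 2: "(\<Prod>i=1..n. Gamma (1 + of_nat (\<nu> i)) :: complex) = (\<Prod>j=2..n. fact (\<nu> j))"
      unfolding eq using \<nu>1 by (simp add: Gamma_fact)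
    show "1 / P k * (x ^ k / fact k) / (\<Prod>i=1..n. Gamma (1 + of_nat (\<nu> i))) =
      of_real (\<Prod>j=1..n. 1 / Gamma (real (\<nu> j) + real k + 1)) * x ^ k"
      unfolding 1 2 P by (simp add: field_simps)
  qed
  finally show ?thesis ..
qed

text \<open>Shifting the contour variable by \<open>\<nu> n\<close> turns the lower parameters into
  \<open>\<nu> j\<close> and the abscissa into \<open>a > 0\<close>; it releases a factor
  \<open>1 / x ^ \<nu> n\<close>, which the prefactor cancels.\<close>

lemma meijer_G_eq_radial_conv:
  assumes n: "n \<ge> 1" and \<nu>1: "\<nu> 1 = 0" and c: "c > real (\<nu> n)" and x: "x > 0"
  shows "of_real (x ^ \<nu> n) * meijer_G c {1..n} (\<lambda>j. real (\<nu> j) - real (\<nu> n)) x =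
    of_real (radial_conv (\<lambda>j u. u ^ \<nu> j * exp (- u)) n x / pi ^ (n - 1))"
proof -
  define a where "a = c - real (\<nu> n)"
  have a: "a > 0" using c by (simp add: a_def)
  have "(\<Prod>j=1..n. Gamma (of_real (real (\<nu> j) - real (\<nu> n)) + Complex c t)) * of_real x powr (- Complex c t) * \<i> =
     of_real (1 / x ^ \<nu> n) * \<i> * ((\<Prod>j=1..n. Gamma (of_nat (\<nu> j) + Complex a t)) * of_real x powr (- Complex a t))" for t
  proof -
    have 1: "of_real (real (\<nu> j) - real (\<nu> n)) + Complex c t = of_nat (\<nu> j) + Complex a t" for j
      by (simp add: a_def complex_eq_iff)
    have "- Complex c t = - Complex a t - of_nat (\<nu> n)"
      by (simp add: a_def complex_eq_iff)
    then have "of_real x powr (- Complex c t) = of_real x powr (- Complex a t) / of_real x ^ \<nu> n"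
      using x by (simp add: powr_diff powr_nat')
    then show ?thesis unfolding 1 by simp
  qed
  then have "meijer_G c {1..n} (\<lambda>j. real (\<nu> j) - real (\<nu> n)) x =
     1 / (2 * of_real pi * \<i>) * (of_real (1 / x ^ \<nu> n) * \<i> *
       of_real (2 * pi / pi ^ (n - 1) * radial_conv (\<lambda>j u. u ^ \<nu> j * exp (- u)) n x))"
    unfolding meijer_G_def using radial_conv_exp_eq_Mellin_Barnes[where \<nu> = \<nu>, OF n \<nu>1 a x]
    by (simp only: integral_mult_right_zero)
  then show ?thesis using x by (simp add: field_simps)
qed

lemma limit_weight_eq_radial_conv:
  assumes n: "n \<ge> 1" and \<nu>1: "\<nu> 1 = 0" and c: "c > real (\<nu> n)"
    and nondeg: "(\<forall>j\<in>{2..n}. \<nu> j > 0) \<or> \<xi> \<noteq> 0"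
  shows "limit_weight c \<nu> n \<xi> = of_real (radial_conv (\<lambda>j u. u ^ \<nu> j * exp (- u)) n ((norm \<xi>)\<^sup>2) / pi ^ (n - 1))"
proof -
  define w where "w z = complex_of_real (norm z ^ (2 * \<nu> n)) *
    meijer_G c {1..n} (\<lambda>j. real (\<nu> j) - real (\<nu> n)) ((norm z)\<^sup>2)" for z :: complex
  define W where "W z = radial_conv (\<lambda>j u. u ^ \<nu> j * exp (- u)) n ((norm z)\<^sup>2)" for z :: complex
  have w: "w z = of_real (W z / pi ^ (n - 1))" if "z \<noteq> 0" for z
    unfolding w_def W_def power_mult using that by (intro meijer_G_eq_radial_conv[where \<nu> = \<nu>, OF n \<nu>1 c]) simp
  have "limit_weight c \<nu> n \<xi> = (if \<xi> = 0 then Lim (at 0) w else w \<xi>)"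
    by (simp add: limit_weight_def w_def[abs_def] Let_def)
  also have "\<dots> = of_real (W \<xi> / pi ^ (n - 1))"
  proof (cases "\<xi> = 0")
    case True
    then have pos: "\<forall>j\<in>{2..n}. \<nu> j > 0" using nondeg by simp
    \<comment> \<open>The functions at finite \<open>N\<close> serve as approximants here: their
      continuous convergence forces continuity of \<open>W\<close> at 0.\<close>
    have "(W \<longlongrightarrow> W 0) (at 0 within UNIV)"
    proof (rule tendsto_limit_of_continuous_convergence)
      fix \<phi> :: "nat \<Rightarrow> nat" and X and x :: complex
      assume "strict_mono \<phi>" "X \<longlonglongrightarrow> x"
      then show "(\<lambda>k. radial_conv (\<lambda>j u. u ^ \<nu> j / (1 + u / \<phi> k) ^ (\<nu> j + \<phi> k + 1)) n ((norm (X k))\<^sup>2)) \<longlonglongrightarrow> W x"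
        unfolding W_def using pos
        by (intro radial_conv_tendsto \<nu>1 tendsto_intros filterlim_subseq) auto
    qed simp
    then have "((\<lambda>z. complex_of_real (W z / pi ^ (n - 1))) \<longlongrightarrow> of_real (W 0 / pi ^ (n - 1))) (at 0)"
      by (intro tendsto_intros) auto
    moreover have "eventually (\<lambda>z. complex_of_real (W z / pi ^ (n - 1)) = w z) (at 0)"
      by (auto simp: eventually_at_filter w)
    ultimately have "(w \<longlongrightarrow> of_real (W 0 / pi ^ (n - 1))) (at 0)"
      by (rule Lim_transform_eventually)
    then show ?thesis using True by (simp add: tendsto_Lim)
  qed (simp add: w)
  finally show ?thesis by (simp add: W_def)
qed

theorem proposition5p5:
  fixes n :: nat and \<nu> :: "nat \<Rightarrow> nat" and c :: real and S :: "complex set"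
  assumes "n \<ge> 1"
    and "\<nu> 1 = 0" and "mono_on {1..n} \<nu>"
    and "c > - Min ((\<lambda>j. real (\<nu> j) - real (\<nu> n)) ` {1..n})"
    and "compact S"
    and "n = 1 \<or> \<nu> 2 > 0 \<or> 0 \<notin> S"
  shows "uniform_limit (S \<times> S)
    (\<lambda>N (\<xi>, \<eta>). 1 / of_nat N ^ n *
       product_kernel \<nu> n N (\<xi> / of_real (real N powr (real n / 2))) (\<eta> / of_real (real N powr (real n / 2))))
    (\<lambda>(\<xi>, \<eta>). csqrt (limit_weight c \<nu> n \<xi> * limit_weight c \<nu> n \<eta>) /
       (of_real pi * (\<Prod>i=1..n. Gamma (1 + of_nat (\<nu> i)))) *
       hypergeom_0F {2..n} (\<lambda>i. 1 + of_nat (\<nu> i)) (\<xi> * cnj \<eta>))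
    sequentially"
proof (rule uniform_limit_of_continuous_convergence)
  show "compact (S \<times> S)"
    using assms(5) by (intro compact_Times)
next
  fix \<phi> :: "nat \<Rightarrow> nat" and X and p :: "complex \<times> complex"
  assume \<phi>: "strict_mono \<phi>" and X: "X \<longlonglongrightarrow> p" and p: "p \<in> S \<times> S"
  note n = assms(1) and \<nu>1 = assms(2)
  have \<phi>': "filterlim \<phi> at_top sequentially" by (rule filterlim_subseq[OF \<phi>])
  define \<xi> \<eta> where "\<xi> = fst p" and "\<eta> = snd p"
  define W where "W N x = radial_conv (\<lambda>j u. u ^ \<nu> j / (1 + u / real N) ^ (\<nu> j + N + 1)) n x" for N x
  define Winf where "Winf = radial_conv (\<lambda>j u. u ^ \<nu> j * exp (- u)) n"
  \<comment> \<open>The index 1, with \<open>\<nu> 1 = 0\<close>, bounds the minimum by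
    \<open>- \<nu> n\<close>, so the contour condition gives \<open>c > \<nu> n\<close>.\<close>
  have "Min ((\<lambda>j. real (\<nu> j) - real (\<nu> n)) ` {1..n}) \<le> real (\<nu> 1) - real (\<nu> n)"
    using n by (intro Min_le) auto
  then have c: "c > real (\<nu> n)" using assms(4) \<nu>1 by simp
  have nondeg: "(\<forall>j\<in>{2..n}. \<nu> j > 0) \<or> \<zeta> \<noteq> 0" if "\<zeta> \<in> S" for \<zeta>
  proof (cases "0 \<in> S")
    case True
    \<comment> \<open>For \<open>n = 1\<close> there is no such \<open>j\<close>; otherwise
      monotonicity carries positivity upwards from \<open>\<nu> 2\<close>.\<close>
    have "\<nu> j > 0" if "j \<in> {2..n}" for j
      using True assms(6) mono_onD[OF assms(3), of 2 j] that by auto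
    then show ?thesis by blast
  qed (use that in auto)
  have W_lim: "(\<lambda>k. W (\<phi> k) ((norm (Y k))\<^sup>2)) \<longlonglongrightarrow> Winf ((norm \<zeta>)\<^sup>2)"
    if "Y \<longlonglongrightarrow> \<zeta>" "\<zeta> \<in> S" for Y \<zeta>
    unfolding W_def Winf_def using nondeg[OF that(2)] that(1)
    by (intro radial_conv_tendsto \<phi>' tendsto_intros \<nu>1) auto
  have fst: "(\<lambda>k. fst (X k)) \<longlonglongrightarrow> \<xi>" and snd: "(\<lambda>k. snd (X k)) \<longlonglongrightarrow> \<eta>"
    unfolding \<xi>_def \<eta>_def by (intro tendsto_intros X)+
  have S: "\<xi> \<in> S" "\<eta> \<in> S" using p by (auto simp: \<xi>_def \<eta>_def)
  have "(\<lambda>k. of_real (1 / pi ^ n * sqrt (W (\<phi> k) ((norm (fst (X k)))\<^sup>2) * W (\<phi> k) ((norm (snd (X k)))\<^sup>2))) *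
      (\<Sum>i<\<phi> k. of_real (\<Prod>j=1..n. kernel_coeff (\<nu> j) (\<phi> k) i / Gamma (real (\<nu> j) + real i + 1)) *
        (fst (X k) * cnj (snd (X k))) ^ i)) \<longlonglongrightarrow>
    of_real (1 / pi ^ n * sqrt (Winf ((norm \<xi>)\<^sup>2) * Winf ((norm \<eta>)\<^sup>2))) *
      (\<Sum>i. of_real (\<Prod>j=1..n. 1 / Gamma (real (\<nu> j) + real i + 1)) * (\<xi> * cnj \<eta>) ^ i)"
    by (intro tendsto_mult tendsto_of_real tendsto_const tendsto_real_sqrt W_lim fst snd S
        kernel_sum_tendsto \<phi>' n \<nu>1 tendsto_cnj)
  moreover have "eventually (\<lambda>k. of_real (1 / pi ^ n * sqrt (W (\<phi> k) ((norm (fst (X k)))\<^sup>2) * W (\<phi> k) ((norm (snd (X k)))\<^sup>2))) *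
      (\<Sum>i<\<phi> k. of_real (\<Prod>j=1..n. kernel_coeff (\<nu> j) (\<phi> k) i / Gamma (real (\<nu> j) + real i + 1)) *
        (fst (X k) * cnj (snd (X k))) ^ i) =
      (case X k of (\<xi>, \<eta>) \<Rightarrow> 1 / of_nat (\<phi> k) ^ n *
       product_kernel \<nu> n (\<phi> k) (\<xi> / of_real (real (\<phi> k) powr (real n / 2))) (\<eta> / of_real (real (\<phi> k) powr (real n / 2)))))
     sequentially"
    using filterlim_at_top[THEN iffD1, OF \<phi>', rule_format, of 1]
    by eventually_elim (simp only: W_def split_beta scaled_product_kernel_eq[OF n])
  ultimately have lim: "(\<lambda>k. case X k of (\<xi>, \<eta>) \<Rightarrow> 1 / of_nat (\<phi> k) ^ n *
       product_kernel \<nu> n (\<phi> k) (\<xi> / of_real (real (\<phi> k) powr (real n / 2))) (\<eta> / of_real (real (\<phi> k) powr (real n / 2))))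
    \<longlonglongrightarrow> of_real (1 / pi ^ n * sqrt (Winf ((norm \<xi>)\<^sup>2) * Winf ((norm \<eta>)\<^sup>2))) *
      (\<Sum>i. of_real (\<Prod>j=1..n. 1 / Gamma (real (\<nu> j) + real i + 1)) * (\<xi> * cnj \<eta>) ^ i)"
    by (rule Lim_transform_eventually)
  \<comment> \<open>The product of the two weights is a nonnegative real, so the principal complex
    root is the real one.\<close>
  have "csqrt (limit_weight c \<nu> n \<xi> * limit_weight c \<nu> n \<eta>) =
      of_real (sqrt (Winf ((norm \<xi>)\<^sup>2) * Winf ((norm \<eta>)\<^sup>2)) / pi ^ (n - 1))"
  proof -
    have "limit_weight c \<nu> n \<xi> * limit_weight c \<nu> n \<eta> =
        of_real (Winf ((norm \<xi>)\<^sup>2) * Winf ((norm \<eta>)\<^sup>2) / (pi ^ (n - 1))\<^sup>2)"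
      using limit_weight_eq_radial_conv[where \<nu> = \<nu>, OF n \<nu>1 c nondeg[OF S(1)]]
        limit_weight_eq_radial_conv[where \<nu> = \<nu>, OF n \<nu>1 c nondeg[OF S(2)]]
      by (simp add: Winf_def power2_eq_square)
    moreover have "0 \<le> Winf ((norm \<xi>)\<^sup>2) * Winf ((norm \<eta>)\<^sup>2) / (pi ^ (n - 1))\<^sup>2"
      by (auto simp: Winf_def intro!: mult_nonneg_nonneg divide_nonneg_nonneg radial_conv_exp_nonneg)
    ultimately show ?thesis
      by (simp only: of_real_sqrt[symmetric] real_sqrt_divide real_sqrt_abs) (simp add: abs_of_nonneg)
  qed
  \<comment> \<open>The power \<open>pi ^ (n - 1)\<close> belongs to the weights; one factor
    \<open>pi\<close> stays in the denominator.\<close>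
  moreover have "pi ^ n = pi * pi ^ (n - 1)"
    using n by (cases n) auto
  ultimately have "of_real (1 / pi ^ n * sqrt (Winf ((norm \<xi>)\<^sup>2) * Winf ((norm \<eta>)\<^sup>2))) *
      (\<Sum>i. of_real (\<Prod>j=1..n. 1 / Gamma (real (\<nu> j) + real i + 1)) * (\<xi> * cnj \<eta>) ^ i) =
    csqrt (limit_weight c \<nu> n \<xi> * limit_weight c \<nu> n \<eta>) /
       (of_real pi * (\<Prod>i=1..n. Gamma (1 + of_nat (\<nu> i)))) *
       hypergeom_0F {2..n} (\<lambda>i. 1 + of_nat (\<nu> i)) (\<xi> * cnj \<eta>)"
    unfolding kernel_series_eq_hypergeom[where \<nu> = \<nu>, OF n \<nu>1] by simp
  then show "(\<lambda>k. case X k of (\<xi>, \<eta>) \<Rightarrow> 1 / of_nat (\<phi> k) ^ n *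
       product_kernel \<nu> n (\<phi> k) (\<xi> / of_real (real (\<phi> k) powr (real n / 2))) (\<eta> / of_real (real (\<phi> k) powr (real n / 2))))
    \<longlonglongrightarrow> (case p of (\<xi>, \<eta>) \<Rightarrow> csqrt (limit_weight c \<nu> n \<xi> * limit_weight c \<nu> n \<eta>) /
       (of_real pi * (\<Prod>i=1..n. Gamma (1 + of_nat (\<nu> i)))) *
       hypergeom_0F {2..n} (\<lambda>i. 1 + of_nat (\<nu> i)) (\<xi> * cnj \<eta>))"
    using lim by (simp only: \<xi>_def \<eta>_def split_beta)
qed

end
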